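(* Let $g\ge 2$, let $c=(c_{-1},c_0,\dots,c_g)$ be such that the spectral curve $\gamma$ is a nonsingular hyperelliptic curve of genus $g$, and let $\mathcal U_c$ be the corresponding isolevel set of the periodic discrete Toda lattice. Let $A=\bigl(0,\prod_{i=1}^{g+1}V_i-\prod_{i=1}^{g+1}I_i\bigr)\in\gamma$ (a point depending only on $c$), let $$T=\begin{cases}A+\frac{g-2}{2}(P_\infty+P_\infty')+P_\infty& g\text{ even},\\ A+\frac{g-3}{2}(P_\infty+P_\infty')+2P_\infty& g\text{ odd},\end{cases}$$ and let $\tau=\mu(T)\in\mathrm{Sym}^g(\gamma)$. Then the time evolution $\chi:\mathcal U_c\to\mathcal U_c$ and the addition of $\tau$ on $\mathrm{Sym}^g(\gamma)$ are intertwined by $\mu\circ\phi$: for every $U\in\mathcal U_c$, $$(\mu\circ\phi)(\chi(U))=(\mu\circ\phi)(U)\oplus\tau ,$$ i.e. $\tilde\Phi\bigl((\mu\circ\phi)(\chi(U))\bigr)=\tilde\Phi\bigl((\mu\circ\phi)(U)\bigr)+\tilde\Phi(\tau)$ in $\mathrm{Pic}^0(\gamma)$.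
   Context: Periodic discrete Toda lattice (pdTL). Let $g\ge2$, indices mod $g+1$. The phase space is $\mathcal U=\{U=(I_1,\dots,I_{g+1},V_1,\dots,V_{g+1})\in\mathbb C^{2g+2}: 0<\prod V_i<\prod I_i\}$. The time evolution $\chi:U\mapsto \bar U=(\bar I_1,\dots,\bar I_{g+1},\bar V_1,\dots,\bar V_{g+1})$ is $$\bar I_i=V_i+I_i\frac{1-\frac{V_1\cdots V_{g+1}}{I_1\cdots I_{g+1}}}{1+\frac{V_{i-1}}{I_{i-1}}+\frac{V_{i-1}V_{i-2}}{I_{i-1}I_{i-2}}+\cdots+\frac{V_{i-1}\cdots V_{i+1}}{I_{i-1}\cdots I_{i+1}}},\qquad \bar V_i=\frac{I_{i+1}V_i}{\bar I_i},$$ which on $\mathcal U$ is equivalent to $\bar I_i+\bar V_{i-1}=I_i+V_i$, $\bar V_i\bar I_i=I_{i+1}V_i$. (All points are assumed to be such that these expressions are defined.) Lax matrix. $L=(l_{ij})$ is the $(g+1)\times(g+1)$ matrix, depending on a spectral parameter $y$, with diagonal entries $l_{ii}=I_{i+1}+V_i$ (so $l_{g+1,g+1}=I_1+V_{g+1}$), superdiagonal entries $1$, subdiagonal entries $l_{i,i-1}=I_iV_i$ ($i=2,\dots,g+1$), upper-right corner $(-1)^gI_1V_1/y$ and lower-left corner $(-1)^gy$ (corners added to other entries falling at the same position; all other entries $0$). One has $\tilde f(x,y):=y\det(x\,\mathrm{Id}+L)=y^2+y(x^{g+1}+c_gx^g+\cdots+c_1x+c_0)+c_{-1}$, which defines polynomials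 $c_{-1},\dots,c_g$ in the $I_i,V_i$; in particular $c_{-1}=\prod I_iV_i$, $c_0=\prod I_i+\prod V_i$. The $c_i$ are conserved by $\chi$. The isolevel set $\mathcal U_c$ is the set of $U\in\mathcal U$ with given values $c=(c_{-1},\dots,c_g)$. Spectral curve. $\gamma$ is the smooth completion of the affine curve $v^2=(u^{g+1}+c_gu^g+\cdots+c_0)^2-4c_{-1}$ in $\mathbb C^2_{(u,v)}$, with two points at infinity $P_\infty$ (where $v/u^{g+1}\to1$) and $P'_\infty$ (where $v/u^{g+1}\to-1$). The map $\rho(x,y)=(x,\,y-c_{-1}/y)$ sends the curve $\tilde f=0$ to $\gamma$. Eigenvector map. For $i=1,\dots,g$ let $\varphi_i(x,y)$ be the determinant of the $g\times g$ matrix obtained from the upper-left $g\times g$ block of $x\,\mathrm{Id}+L$ by replacing its $i$-th column by $(l_{1,g+1},\dots,l_{g,g+1})^T$. There are exactly $g$ points $\tilde P_1,\dots,\tilde P_g$ (with multiplicity) with $\varphi_1=\varphi_2=0$; they lie on $\tilde f=0$, and their $x$-coordinates are the roots of the determinant of the upper-left $g\times g$ block of $x\,\mathrm{Id}+L$. Put $P_i=\rho(\tilde P_i)\in\gamma$. Then $\phi(U)$ is the effective divisor $P_1+\dots+P_g$ (a representative of its class of degree $g$). Addition. $\mathcal D_g^+(\gamma)$ is the set of effective divisors of degree $g$, $\mu:\mathcal D_g^+(\gamma)\to\mathrm{Sym}^g(\gamma)$ is the bijection $P_1+\dots+P_g\mapsto\{P_1,\dots,P_g\}$, $\mathrm{Pic}^0(\gamma)$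 is the group of degree-$0$ divisors modulo principal divisors. Put $D^\ast=\frac g2(P_\infty+P'_\infty)$ for $g$ even and $D^\ast=\frac{g-1}2(P_\infty+P_\infty')+P_\infty$ for $g$ odd, $\Phi(D)=[D-D^\ast]\in\mathrm{Pic}^0(\gamma)$ for $D\in\mathcal D_g^+(\gamma)$ and $\tilde\Phi=\Phi\circ\mu^{-1}$ (a surjection). For $d_1,d_2\in\mathrm{Sym}^g(\gamma)$, $d_1\oplus d_2$ denotes an element of $\tilde\Phi^{-1}(\tilde\Phi(d_1)+\tilde\Phi(d_2))$ (not always unique); "$d=d_1\oplus d_2$" means $d$ belongs to this set. *)

theory Defs
  imports
    "HOL-Complex_Analysis.Complex_Analysis"
    "HOL-Algebra.Free_Abelian_Groups"
    "HOL-Library.Multiset"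
    "Jordan_Normal_Form.Determinant"
begin

section \<open>The periodic discrete Toda lattice\<close>

text \<open>
  A point \<open>(I\<^sub>1,\<dots>,I\<^sub>g\<^sub>+\<^sub>1,V\<^sub>1,\<dots>,V\<^sub>g\<^sub>+\<^sub>1)\<close> of the phase space is a pair of sequences \<open>(I, V)\<close> indexed by
  the integers and periodic with period \<open>g + 1\<close>.
\<close>

type_synonym toda = "(int \<Rightarrow> complex) \<times> (int \<Rightarrow> complex)"

definition cyclic :: "nat \<Rightarrow> (int \<Rightarrow> complex) \<Rightarrow> bool" where
  "cyclic g a \<longleftrightarrow> (\<forall>i. a (i + int (g + 1)) = a i)"

definition total_prod :: "nat \<Rightarrow> (int \<Rightarrow> complex) \<Rightarrow> complex" where
  "total_prod g a = (\<Prod>i = 1..int (g + 1). a i)"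

definition phase_space :: "nat \<Rightarrow> toda set" where
  "phase_space g = {(I, V). cyclic g I \<and> cyclic g V \<and>
     (\<exists>a b :: real. total_prod g V = of_real a \<and> total_prod g I = of_real b \<and> 0 < a \<and> a < b)}"

definition toda_denom :: "nat \<Rightarrow> (int \<Rightarrow> complex) \<Rightarrow> (int \<Rightarrow> complex) \<Rightarrow> int \<Rightarrow> complex" where
  "toda_denom g I V i = 1 + (\<Sum>k = 1..g. \<Prod>j = 1..k. V (i - int j) / I (i - int j))"

definition I_bar :: "nat \<Rightarrow> (int \<Rightarrow> complex) \<Rightarrow> (int \<Rightarrow> complex) \<Rightarrow> int \<Rightarrow> complex" where
  "I_bar g I V i = V i + I i * ((1 - total_prod g V / total_prod g I) / toda_denom g I V i)"

definition V_bar :: "nat \<Rightarrow> (int \<Rightarrow> complex) \<Rightarrow> (int \<Rightarrow> complex) \<Rightarrow> int \<Rightarrow> complex" where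
  "V_bar g I V i = I (i + 1) * V i / I_bar g I V i"

fun chi :: "nat \<Rightarrow> toda \<Rightarrow> toda" where
  "chi g (I, V) = (I_bar g I V, V_bar g I V)"

text \<open>All divisors occurring in the formulas for \<^const>\<open>chi\<close> are nonzero.\<close>

fun chi_defined :: "nat \<Rightarrow> toda \<Rightarrow> bool" where
  "chi_defined g (I, V) \<longleftrightarrow> (\<forall>i. I i \<noteq> 0 \<and> toda_denom g I V i \<noteq> 0 \<and> I_bar g I V i \<noteq> 0)"


section \<open>The Lax matrix and the isolevel sets\<close>

text \<open>Rows and columns \<open>i\<close>, \<open>j\<close> of \<open>lax_entry\<close> are counted from 1.\<close>

fun lax_entry :: "nat \<Rightarrow> toda \<Rightarrow> complex \<Rightarrow> nat \<Rightarrow> nat \<Rightarrow> complex" where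
  "lax_entry g (I, V) y i j =
     (if i = j then I (int i + 1) + V (int i) else 0)
   + (if j = i + 1 then 1 else 0)
   + (if i = j + 1 then I (int i) * V (int i) else 0)
   + (if i = 1 \<and> j = g + 1 then (-1) ^ g * (I 1 * V 1) / y else 0)
   + (if i = g + 1 \<and> j = 1 then (-1) ^ g * y else 0)"

definition lax :: "nat \<Rightarrow> toda \<Rightarrow> complex \<Rightarrow> complex mat" where
  "lax g U y = Matrix.mat (g + 1) (g + 1) (\<lambda>(i, j). lax_entry g U y (i + 1) (j + 1))"

definition f_tilde :: "nat \<Rightarrow> toda \<Rightarrow> complex \<Rightarrow> complex \<Rightarrow> complex" where
  "f_tilde g U x y = y * Determinant.det (x \<cdot>\<^sub>m 1\<^sub>m (g + 1) + lax g U y)"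

text \<open>
  The conserved quantities \<open>c\<^sub>-\<^sub>1, c\<^sub>0, \<dots>, c\<^sub>g\<close> are given by \<open>c :: int \<Rightarrow> complex\<close>; only its values
  on \<open>{-1..g}\<close> matter.
\<close>

definition spec_poly :: "nat \<Rightarrow> (int \<Rightarrow> complex) \<Rightarrow> complex poly" where
  "spec_poly g c = Polynomial.monom 1 (g + 1) + (\<Sum>i = 0..g. Polynomial.monom (c (int i)) i)"

definition isolevel :: "nat \<Rightarrow> (int \<Rightarrow> complex) \<Rightarrow> toda set" where
  "isolevel g c = {U \<in> phase_space g.
     \<forall>x y. y \<noteq> 0 \<longrightarrow> f_tilde g U x y = y ^ 2 + y * poly (spec_poly g c) x + c (-1)}"


section \<open>The spectral curve\<close>

text \<open>
  \<open>PInf\<close> and \<open>PInf'\<close> are the points at infinity where \<open>v / u ^ (g + 1)\<close> tends to \<open>1\<close> and \<open>-1\<close>.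
\<close>

datatype point = Aff complex complex | PInf | PInf'

definition curve_poly :: "nat \<Rightarrow> (int \<Rightarrow> complex) \<Rightarrow> complex poly" where
  "curve_poly g c = spec_poly g c ^ 2 - [:4 * c (-1):]"

definition gam :: "nat \<Rightarrow> (int \<Rightarrow> complex) \<Rightarrow> point set" where
  "gam g c = {Aff u v | u v. v ^ 2 = poly (curve_poly g c) u} \<union> {PInf, PInf'}"

text \<open>
  The gradient of \<open>v\<^sup>2 - F(u)\<close>, where \<open>F\<close> is the monic polynomial \<^const>\<open>curve_poly\<close> of degree
  \<open>2 * g + 2\<close>, vanishes nowhere on the affine curve. Since \<open>F\<close> is then squarefree, the completed
  curve is automatically hyperelliptic of genus \<open>g\<close> (for \<open>g \<ge> 2\<close>).
\<close>

definition nonsingular_curve :: "nat \<Rightarrow> (int \<Rightarrow> complex) \<Rightarrow> bool" where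
  "nonsingular_curve g c \<longleftrightarrow>
     (\<forall>u v. v ^ 2 = poly (curve_poly g c) u \<longrightarrow>
        \<not> (2 * v = 0 \<and> - poly (pderiv (curve_poly g c)) u = 0))"

text \<open>
  Local parametrizations \<open>t \<mapsto> (x t, y t)\<close> of the curve near a point, which corresponds to \<open>t = 0\<close>.
  Near infinity the completion is the curve \<open>w\<^sup>2 = s ^ (2 * g + 2) * F(1/s)\<close>, glued in by
  \<open>u = 1 / s\<close> and \<open>v = w / s ^ (g + 1)\<close>; the right-hand side is the reflected polynomial of \<open>F\<close>.
\<close>

definition aff_param :: "complex poly \<Rightarrow> (complex \<Rightarrow> complex) \<Rightarrow> (complex \<Rightarrow> complex) \<Rightarrow> bool" where
  "aff_param F x y \<longleftrightarrow> x analytic_on {0} \<and> y analytic_on {0} \<and>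
     (\<forall>\<^sub>F t in nhds 0. y t ^ 2 = poly F (x t)) \<and> (deriv x 0 \<noteq> 0 \<or> deriv y 0 \<noteq> 0)"

definition inf_param ::
  "nat \<Rightarrow> (int \<Rightarrow> complex) \<Rightarrow> complex \<Rightarrow> (complex \<Rightarrow> complex) \<Rightarrow> (complex \<Rightarrow> complex) \<Rightarrow> bool" where
  "inf_param g c w0 x y \<longleftrightarrow> (\<exists>s w. aff_param (reflect_poly (curve_poly g c)) s w \<and>
     s 0 = 0 \<and> w 0 = w0 \<and> x = (\<lambda>t. 1 / s t) \<and> y = (\<lambda>t. w t / s t ^ (g + 1)))"

fun local_param ::
  "nat \<Rightarrow> (int \<Rightarrow> complex) \<Rightarrow> point \<Rightarrow> (complex \<Rightarrow> complex) \<Rightarrow> (complex \<Rightarrow> complex) \<Rightarrow> bool" where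
  "local_param g c (Aff u v) x y \<longleftrightarrow> aff_param (curve_poly g c) x y \<and> x 0 = u \<and> y 0 = v"
| "local_param g c PInf x y \<longleftrightarrow> inf_param g c 1 x y"
| "local_param g c PInf' x y \<longleftrightarrow> inf_param g c (-1) x y"

text \<open>
  Order of a rational function at a point of a nonsingular curve (positive at zeros, negative at
  poles). It does not depend on the chosen local parametrization.
\<close>

definition ord_at ::
  "nat \<Rightarrow> (int \<Rightarrow> complex) \<Rightarrow> point \<Rightarrow> (complex \<Rightarrow> complex \<Rightarrow> complex) \<Rightarrow> int" where
  "ord_at g c P f =
     (let (x, y) = (SOME (x, y). local_param g c P x y) in zorder (\<lambda>t. f (x t) (y t)) 0)"


section \<open>Divisors and the Picard group\<close>

text \<open>The inner polynomial variable is \<open>u\<close>, the outer one is \<open>v\<close>.\<close>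

definition poly_uv :: "complex poly poly \<Rightarrow> complex \<Rightarrow> complex \<Rightarrow> complex" where
  "poly_uv N u v = poly (poly N [:v:]) u"

definition nonzero_on_curve :: "nat \<Rightarrow> (int \<Rightarrow> complex) \<Rightarrow> complex poly poly \<Rightarrow> bool" where
  "nonzero_on_curve g c N \<longleftrightarrow> (\<exists>u v. Aff u v \<in> gam g c \<and> poly_uv N u v \<noteq> 0)"

text \<open>\<open>E\<close> is the divisor of a nonzero rational function \<open>N / M\<close> on the curve.\<close>

definition principal_div :: "nat \<Rightarrow> (int \<Rightarrow> complex) \<Rightarrow> (point \<Rightarrow>\<^sub>0 int) \<Rightarrow> bool" where
  "principal_div g c E \<longleftrightarrow> (\<exists>N M. nonzero_on_curve g c N \<and> nonzero_on_curve g c M \<and>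
     (\<forall>P \<in> gam g c. Poly_Mapping.lookup E P =
        ord_at g c P (\<lambda>u v. poly_uv N u v / poly_uv M u v)))"

definition Div :: "nat \<Rightarrow> (int \<Rightarrow> complex) \<Rightarrow> (point \<Rightarrow>\<^sub>0 int) monoid" where
  "Div g c = free_Abelian_group (gam g c)"

definition div_degree :: "(point \<Rightarrow>\<^sub>0 int) \<Rightarrow> int" where
  "div_degree E = (\<Sum>P \<in> Poly_Mapping.keys E. Poly_Mapping.lookup E P)"

definition Div0 :: "nat \<Rightarrow> (int \<Rightarrow> complex) \<Rightarrow> (point \<Rightarrow>\<^sub>0 int) monoid" where
  "Div0 g c = (Div g c)\<lparr>carrier := {E \<in> carrier (Div g c). div_degree E = 0}\<rparr>"

definition Princ :: "nat \<Rightarrow> (int \<Rightarrow> complex) \<Rightarrow> (point \<Rightarrow>\<^sub>0 int) set" where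
  "Princ g c = {E \<in> carrier (Div0 g c). principal_div g c E}"

text \<open>The group law of the Picard group is written multiplicatively.\<close>

definition Pic0 :: "nat \<Rightarrow> (int \<Rightarrow> complex) \<Rightarrow> (point \<Rightarrow>\<^sub>0 int) set monoid" where
  "Pic0 g c = Div0 g c Mod Princ g c"


section \<open>Addition on the symmetric product\<close>

definition eff_divs :: "nat \<Rightarrow> (int \<Rightarrow> complex) \<Rightarrow> (point \<Rightarrow>\<^sub>0 int) set" where
  "eff_divs g c = {E \<in> carrier (Div g c).
     (\<forall>P. 0 \<le> Poly_Mapping.lookup E P) \<and> div_degree E = int g}"

definition Symg :: "nat \<Rightarrow> (int \<Rightarrow> complex) \<Rightarrow> point multiset set" where
  "Symg g c = {d. set_mset d \<subseteq> gam g c \<and> size d = g}"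

definition mu :: "(point \<Rightarrow>\<^sub>0 int) \<Rightarrow> point multiset" where
  "mu E = (\<Sum>P \<in> Poly_Mapping.keys E. replicate_mset (nat (Poly_Mapping.lookup E P)) P)"

definition D_star :: "nat \<Rightarrow> (point \<Rightarrow>\<^sub>0 int)" where
  "D_star g = (if even g then frag_cmul (int (g div 2)) (frag_of PInf + frag_of PInf')
     else frag_cmul (int ((g - 1) div 2)) (frag_of PInf + frag_of PInf') + frag_of PInf)"

definition Phi :: "nat \<Rightarrow> (int \<Rightarrow> complex) \<Rightarrow> (point \<Rightarrow>\<^sub>0 int) \<Rightarrow> (point \<Rightarrow>\<^sub>0 int) set" where
  "Phi g c E = Princ g c #>\<^bsub>Div0 g c\<^esub> (E - D_star g)"

definition Phi_tilde :: "nat \<Rightarrow> (int \<Rightarrow> complex) \<Rightarrow> point multiset \<Rightarrow> (point \<Rightarrow>\<^sub>0 int) set" where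
  "Phi_tilde g c = Phi g c \<circ> inv_into (eff_divs g c) mu"

text \<open>The sum is not unique, so \<open>d = d\<^sub>1 \<oplus> d\<^sub>2\<close> is expressed by membership in this set.\<close>

definition sym_sum ::
  "nat \<Rightarrow> (int \<Rightarrow> complex) \<Rightarrow> point multiset \<Rightarrow> point multiset \<Rightarrow> point multiset set" where
  "sym_sum g c d1 d2 =
     {d \<in> Symg g c. Phi_tilde g c d = Phi_tilde g c d1 \<otimes>\<^bsub>Pic0 g c\<^esub> Phi_tilde g c d2}"


section \<open>The eigenvector map\<close>

definition lax_block :: "nat \<Rightarrow> toda \<Rightarrow> complex \<Rightarrow> complex mat" where
  "lax_block g U y = Matrix.mat g g (\<lambda>(i, j). lax_entry g U y (i + 1) (j + 1))"

definition ev_minor :: "nat \<Rightarrow> toda \<Rightarrow> nat \<Rightarrow> complex \<Rightarrow> complex \<Rightarrow> complex" where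
  "ev_minor g U k x y = Determinant.det
     (replace_col (x \<cdot>\<^sub>m 1\<^sub>m g + lax_block g U y)
        (Matrix.vec g (\<lambda>i. lax_entry g U y (i + 1) (g + 1))) (k - 1))"

definition ev_points :: "nat \<Rightarrow> toda \<Rightarrow> (complex \<times> complex) set" where
  "ev_points g U = {(x, y). y \<noteq> 0 \<and> ev_minor g U 1 x y = 0 \<and> ev_minor g U 2 x y = 0}"

definition block_poly :: "nat \<Rightarrow> toda \<Rightarrow> complex \<Rightarrow> complex poly" where
  "block_poly g U y = Determinant.det
     ([:0, 1:] \<cdot>\<^sub>m 1\<^sub>m g + map_mat (\<lambda>a. [:a:]) (lax_block g U y))"

text \<open>
  For \<open>g \<ge> 2\<close> the equation \<open>ev_minor g U 1 x y = 0\<close> determines \<open>y\<close> as a polynomial in \<open>x\<close>, and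
  substituting it into \<open>y * ev_minor g U 2 x y\<close> gives \<open>block_poly\<close> up to a nonzero constant
  (\<open>block_poly\<close> does not depend on \<open>y\<close>). So the multiplicity of a solution \<open>(x, y)\<close> is
  the multiplicity of \<open>x\<close> as a root of \<open>block_poly\<close>.
\<close>

definition ev_mult :: "nat \<Rightarrow> toda \<Rightarrow> complex \<times> complex \<Rightarrow> nat" where
  "ev_mult g U = (\<lambda>(x, y). Polynomial.order x (block_poly g U y))"

definition rho :: "(int \<Rightarrow> complex) \<Rightarrow> complex \<times> complex \<Rightarrow> point" where
  "rho c = (\<lambda>(x, y). Aff x (y - c (-1) / y))"

definition phi :: "nat \<Rightarrow> (int \<Rightarrow> complex) \<Rightarrow> toda \<Rightarrow> (point \<Rightarrow>\<^sub>0 int)" where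
  "phi g c U = (\<Sum>Q \<in> ev_points g U. frag_cmul (int (ev_mult g U Q)) (frag_of (rho c Q)))"


section \<open>The translation divisor\<close>

fun A_point :: "nat \<Rightarrow> toda \<Rightarrow> point" where
  "A_point g (I, V) = Aff 0 (total_prod g V - total_prod g I)"

definition T_div :: "nat \<Rightarrow> point \<Rightarrow> (point \<Rightarrow>\<^sub>0 int)" where
  "T_div g A =
     (if even g then frag_of A + frag_cmul (int ((g - 2) div 2)) (frag_of PInf + frag_of PInf')
          + frag_of PInf
      else frag_of A + frag_cmul (int ((g - 3) div 2)) (frag_of PInf + frag_of PInf')
          + frag_cmul 2 (frag_of PInf))"

end

theory Submission
  imports Defs "HOL-Computational_Algebra.Fundamental_Theorem_Algebra"
begin

text \<open>
  Write \<open>D\<^bsub>i..j\<^esub>\<close> for the principal minors of \<open>x + L\<close> without its corners; they are continuants. The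
  divisor of a point of the isolevel set has Mumford representation \<open>u = D\<^bsub>1..g\<^esub>\<close>,
  \<open>v = P + 2 I\<^sub>1 V\<^sub>1 D\<^bsub>2..g\<^esub>\<close>, where \<open>v\<^sup>2 = P\<^sup>2 - 4 c\<^bsub>-1\<^esub>\<close> is the spectral curve. Let \<open>u'\<close> be the
  polynomial \<open>u\<close> of the image under the time evolution and put \<open>s = I\<^sub>1 (D\<^bsub>1..g\<^esub> - V\<^sub>1 D\<^bsub>2..g\<^esub>)\<close>. Identities
  between continuants give \<open>s\<^sup>2 - s P + c\<^bsub>-1\<^esub> = - I\<^sub>1 x u u'\<close>, and the left-hand side is the norm of
  \<open>(v - P) / 2 + s\<close>. Hence the function \<open>((v - P) / 2 + s) / u'\<close> has divisor
  \<open>\<phi>(U) + A - P'\<^sub>\<infinity> - \<phi>(\<chi> U)\<close>, while \<open>T - D\<^sup>* = A - P'\<^sub>\<infinity>\<close> as divisors.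
\<close>

section \<open>Continuants\<close>

text \<open>The equations \<open>v = y - c(-1)/y\<close> and \<open>y + P + c(-1)/y = 0\<close> give
  \<open>y = (v - P) / 2\<close>, so the function is \<open>(y + s) / u'\<close> with the spectral
  parameter \<open>y\<close> as a function on the curve. On the divisor of \<open>U\<close> one has
  \<open>y = I_1 V_1 D_{2..g}\<close> and \<open>D_{1..g} = 0\<close>, hence \<open>s = - y\<close>.
  The term \<open>I_1 D_{1..g}\<close> of \<open>s\<close> keeps these zeros and makes
  \<open>s(0)\<close> the product of all \<open>I_i\<close>, which is the value of
  \<open>- y\<close> at \<open>A\<close>. The norm has degree \<open>2 g + 1\<close>, so
  \<open>g\<close> zeros remain; they are the conjugates of the points of the new divisor. Since
  \<open>u'\<close> vanishes at those points and at their conjugates, the quotient trades the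
  conjugate zeros for poles at the points themselves.

  The obstacle is multiplicity: roots of \<open>u\<close> and \<open>u'\<close> may be multiple,
  common, equal to 0, or branch points. The divisor is therefore not found by listing zeros but by
  comparing orders, point by point, with the order of the norm. Moreover, the order at a point is
  defined by one arbitrarily chosen parametrization, so every order is computed for all of
  them.\<close>

fun continuant :: "(int \<Rightarrow> 'a::comm_ring_1) \<Rightarrow> (int \<Rightarrow> 'a) \<Rightarrow> int \<Rightarrow> nat \<Rightarrow> 'a" where
  "continuant a b i 0 = 1"
| "continuant a b i (Suc 0) = a i"
| "continuant a b i (Suc (Suc k)) =
     a (i + int k + 1) * continuant a b i (Suc k) - b (i + int k + 1) * continuant a b i k"

text \<open>Both sides obey the right-end recursion in the length, so the two shortest cases decide.
  It expands a minor at its left end, which is where the eigenvector minors differ from the block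
  determinant.\<close>

lemma continuant_left:
  "continuant a b i (Suc (Suc k)) =
     a i * continuant a b (i + 1) (Suc k) - b (i + 1) * continuant a b (i + 2) k"
proof (induction k rule: induct_nat_012)
  case (ge2 k)
  have 1: "continuant a b i (Suc (Suc (Suc (Suc k)))) =
    a (i + int k + 3) * continuant a b i (Suc (Suc (Suc k))) - b (i + int k + 3) * continuant a b i (Suc (Suc k))"
    by (subst continuant.simps(3)) (simp add: algebra_simps del: continuant.simps)
  have 2: "continuant a b (i + 1) (Suc (Suc (Suc k))) =
    a (i + int k + 3) * continuant a b (i + 1) (Suc (Suc k)) - b (i + int k + 3) * continuant a b (i + 1) (Suc k)"
    by (subst continuant.simps(3)) (simp add: algebra_simps del: continuant.simps)
  have 3: "continuant a b (i + 2) (Suc (Suc k)) =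
    a (i + int k + 3) * continuant a b (i + 2) (Suc k) - b (i + int k + 3) * continuant a b (i + 2) k"
    by (subst continuant.simps(3)) (simp add: algebra_simps del: continuant.simps)
  show ?case
    unfolding 1 2 3 ge2 by (simp add: algebra_simps del: continuant.simps)
qed (auto simp: algebra_simps)

text \<open>The left side is the Casoratian of two solutions of one three-term recursion (the
  continuants starting at \<open>i\<close> and at \<open>i + 1\<close>), so each step only
  multiplies it by the next \<open>b\<close>.\<close>

lemma continuant_Euler:
  "continuant a b i (Suc k) * continuant a b (i + 1) (Suc k) - continuant a b i (Suc (Suc k)) * continuant a b (i + 1) k
   = (\<Prod>j = 1..Suc k. b (i + int j))"
proof (induction k)
  case (Suc k)
  have 1: "continuant a b i (Suc (Suc (Suc k))) =
    a (i + int k + 2) * continuant a b i (Suc (Suc k)) - b (i + int k + 2) * continuant a b i (Suc k)"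
    by (subst continuant.simps(3)) (simp add: algebra_simps del: continuant.simps)
  have 2: "continuant a b (i + 1) (Suc (Suc k)) =
    a (i + int k + 2) * continuant a b (i + 1) (Suc k) - b (i + int k + 2) * continuant a b (i + 1) k"
    by (subst continuant.simps(3)) (simp add: algebra_simps del: continuant.simps)
  have "continuant a b i (Suc (Suc k)) * continuant a b (i + 1) (Suc (Suc k))
      - continuant a b i (Suc (Suc (Suc k))) * continuant a b (i + 1) (Suc k)
      = b (i + int k + 2) * (continuant a b i (Suc k) * continuant a b (i + 1) (Suc k)
          - continuant a b i (Suc (Suc k)) * continuant a b (i + 1) k)"
    unfolding 1 2 by (simp add: algebra_simps del: continuant.simps)
  also have "\<dots> = b (i + int k + 2) * (\<Prod>j = 1..Suc k. b (i + int j))"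
    by (simp only: Suc)
  also have "\<dots> = (\<Prod>j = 1..Suc (Suc k). b (i + int j))"
    by (simp add: algebra_simps)
  finally show ?case .
qed (auto simp: algebra_simps)

text \<open>
  \<open>lax_cont\<close> is the minor of \<open>x + L\<close> on the indices \<open>i, \<dots>, i + k - 1\<close>, and \<open>shift_cont\<close> is the same minor
  after one time step, because \<open>I'\<^bsub>i+1\<^esub> + V'\<^sub>i = I\<^bsub>i+1\<^esub> + V\<^bsub>i+1\<^esub>\<close> and \<open>I'\<^sub>i V'\<^sub>i = I\<^bsub>i+1\<^esub> V\<^sub>i\<close>. Both are related
  through \<open>cut_cont\<close>, the minor starting at \<open>1\<close> with \<open>V\<^sub>1\<close> removed from its first diagonal entry.
\<close>

definition lax_cont :: "(int \<Rightarrow> 'a::comm_ring_1) \<Rightarrow> (int \<Rightarrow> 'a) \<Rightarrow> 'a \<Rightarrow> int \<Rightarrow> nat \<Rightarrow> 'a" where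
  "lax_cont I V x = continuant (\<lambda>i. x + I (i + 1) + V i) (\<lambda>i. I i * V i)"

definition shift_cont :: "(int \<Rightarrow> 'a::comm_ring_1) \<Rightarrow> (int \<Rightarrow> 'a) \<Rightarrow> 'a \<Rightarrow> int \<Rightarrow> nat \<Rightarrow> 'a" where
  "shift_cont I V x = continuant (\<lambda>i. x + I (i + 1) + V (i + 1)) (\<lambda>i. I (i + 1) * V i)"

lemma lax_cont_simps:
  "lax_cont I V x i 0 = 1"
  "lax_cont I V x i (Suc 0) = x + I (i + 1) + V i"
  "lax_cont I V x i (Suc (Suc k)) = (x + I (i + int k + 2) + V (i + int k + 1)) * lax_cont I V x i (Suc k)
     - I (i + int k + 1) * V (i + int k + 1) * lax_cont I V x i k"
  by (simp_all add: lax_cont_def ac_simps)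

lemma shift_cont_simps:
  "shift_cont I V x i 0 = 1"
  "shift_cont I V x i (Suc 0) = x + I (i + 1) + V (i + 1)"
  "shift_cont I V x i (Suc (Suc k)) = (x + I (i + int k + 2) + V (i + int k + 2)) * shift_cont I V x i (Suc k)
     - I (i + int k + 2) * V (i + int k + 1) * shift_cont I V x i k"
  by (simp_all add: shift_cont_def ac_simps)

definition cut_cont :: "(int \<Rightarrow> 'a::comm_ring_1) \<Rightarrow> (int \<Rightarrow> 'a) \<Rightarrow> 'a \<Rightarrow> nat \<Rightarrow> 'a" where
  "cut_cont I V x k = (if k = 0 then 1 else lax_cont I V x 1 k - V 1 * lax_cont I V x 2 (k - 1))"

lemma cut_cont_simps:
  "cut_cont I V x 0 = 1"
  "cut_cont I V x (Suc 0) = x + I 2"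
  "cut_cont I V x (Suc (Suc k)) = (x + I (int k + 3) + V (int k + 2)) * cut_cont I V x (Suc k)
     - I (int k + 2) * V (int k + 2) * cut_cont I V x k"
proof -
  show "cut_cont I V x (Suc (Suc k)) = (x + I (int k + 3) + V (int k + 2)) * cut_cont I V x (Suc k)
     - I (int k + 2) * V (int k + 2) * cut_cont I V x k"
    by (cases k) (simp_all add: cut_cont_def lax_cont_simps algebra_simps)
qed (simp_all add: cut_cont_def lax_cont_simps)

text \<open>These are the quotient-difference relations. With \<open>q_i = I (i + 1)\<close> and
  \<open>e_i = V (i + 1)\<close>, \<open>cut_cont\<close> gives the even denominators of the
  convergents of \<open>1/(x + q_1/(1 + e_1/(x + ...)))\<close> and \<open>x * shift_cont\<close>
  the odd ones. The induction needs both relations at once.\<close>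

lemma cut_cont_shift_cont:
  "cut_cont I V x (Suc k) = x * shift_cont I V x 1 k + I (int k + 2) * cut_cont I V x k \<and>
   shift_cont I V x 1 (Suc k) = cut_cont I V x (Suc k) + V (int k + 2) * shift_cont I V x 1 k"
proof (induction k)
  case (Suc k)
  have 1: "shift_cont I V x 1 (Suc (Suc k)) =
     (x + I (int k + 3) + V (int k + 3)) * shift_cont I V x 1 (Suc k) - I (int k + 3) * V (int k + 2) * shift_cont I V x 1 k"
    by (simp add: shift_cont_simps ac_simps)
  have 2: "int (Suc k) + 2 = int k + 3" by simp
  have 3: "shift_cont I V x 1 (Suc k) = x * shift_cont I V x 1 k + I (int k + 2) * cut_cont I V x k + V (int k + 2) * shift_cont I V x 1 k"
    "cut_cont I V x (Suc k) = x * shift_cont I V x 1 k + I (int k + 2) * cut_cont I V x k"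
    using Suc by auto
  show ?case
    unfolding 1 2 cut_cont_simps unfolding 3 by (simp add: algebra_simps)
qed (auto simp: cut_cont_simps shift_cont_simps algebra_simps)

text \<open>By the first relation of \<open>cut_cont_shift_cont\<close>, the left side is
  \<open>E_k D_{k+1} - E_{k+1} D_k\<close> with \<open>D = lax_cont\<close> and
  \<open>E = cut_cont\<close>. This is again a Casoratian of two solutions of one recursion: it
  starts at \<open>V 1\<close>, and each step multiplies it by
  \<open>I (k + 2) * V (k + 2)\<close>.\<close>

lemma cut_lax_shift_cont:
  "cut_cont I V x k * (lax_cont I V x 1 (Suc k) - I (int k + 2) * lax_cont I V x 1 k) - x * lax_cont I V x 1 k * shift_cont I V x 1 k
   = (\<Prod>j = 1..Suc k. V (int j)) * (\<Prod>j = 1..k. I (int j + 1))"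
proof (induction k)
  case (Suc k)
  let ?D = "lax_cont I V x 1" and ?E = "cut_cont I V x" and ?F = "shift_cont I V x 1"
  have 1: "?D (Suc (Suc k)) =
     (x + I (int k + 3) + V (int k + 2)) * ?D (Suc k) - I (int k + 2) * V (int k + 2) * ?D k"
    by (simp add: lax_cont_simps ac_simps)
  note 2 = conjunct1[OF cut_cont_shift_cont[of I V x k]] conjunct2[OF cut_cont_shift_cont[of I V x k]]
  have 3: "int (Suc k) + 2 = int k + 3" by simp
  have "?E (Suc k) * (?D (Suc (Suc k)) - I (int k + 3) * ?D (Suc k)) - x * ?D (Suc k) * ?F (Suc k)
     = V (int k + 2) * (?E (Suc k) * (?D (Suc k) - I (int k + 2) * ?D k) - x * ?D (Suc k) * ?F k)"
    unfolding 1 2(2) by (simp add: algebra_simps)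
  also have "\<dots> = V (int k + 2) * I (int k + 2) *
      (?E k * (?D (Suc k) - I (int k + 2) * ?D k) - x * ?D k * ?F k)"
    unfolding 2(1) by (simp add: algebra_simps)
  also have "\<dots> = (\<Prod>j = 1..Suc (Suc k). V (int j)) * (\<Prod>j = 1..Suc k. I (int j + 1))"
    unfolding Suc by (simp add: algebra_simps)
  finally show ?case unfolding 3 .
qed (auto simp: lax_cont_simps cut_cont_simps shift_cont_simps)

text \<open>The left side is the shifted minor with \<open>I 2\<close> removed from its first
  diagonal entry, the right side the Lax minor with \<open>I (k + 3)\<close> removed from its last
  one. Both are characteristic polynomials of products of the same two bidiagonal matrices, taken in
  opposite orders. The proof compares their recursions.\<close>

lemma shift_cont_lax_cont:
  "shift_cont I V x 1 (Suc k) - I 2 * shift_cont I V x 2 k = lax_cont I V x 2 (Suc k) - I (int k + 3) * lax_cont I V x 2 k"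
proof (induction k rule: induct_nat_012)
  case (ge2 k)
  let ?D = "lax_cont I V x 2"
  define G where "G k = shift_cont I V x 1 (Suc k) - I 2 * shift_cont I V x 2 k" for k
  have rec: "G (Suc (Suc k)) = (x + I (int k + 4) + V (int k + 4)) * G (Suc k)
      - I (int k + 4) * V (int k + 3) * G k"
    unfolding G_def shift_cont_simps(3)[of _ _ _ 1 "Suc k"] shift_cont_simps(3)[of _ _ _ 2 "k"]
    by (simp add: algebra_simps)
  have 1: "?D (Suc (Suc k)) =
     (x + I (int k + 4) + V (int k + 3)) * ?D (Suc k) - I (int k + 3) * V (int k + 3) * ?D k"
    by (simp add: lax_cont_simps ac_simps)
  have 2: "?D (Suc (Suc (Suc k))) =
     (x + I (int k + 5) + V (int k + 4)) * ?D (Suc (Suc k)) - I (int k + 4) * V (int k + 4) * ?D (Suc k)"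
    by (simp add: lax_cont_simps(3)[of _ _ _ _ "Suc k"] ac_simps)
  have 3: "int (Suc k) + 3 = int k + 4" "int (Suc (Suc k)) + 3 = int k + 5" by simp_all
  show ?case
    unfolding G_def[symmetric] rec ge2[folded G_def] 3 2 unfolding 1
    by (simp add: algebra_simps)
qed (auto simp: lax_cont_simps shift_cont_simps algebra_simps)

section \<open>Determinants of tridiagonal matrices\<close>

lemma laplace_column_support:
  assumes "(A :: 'a :: comm_ring_1 mat) \<in> carrier_mat n n" "j < n" "S \<subseteq> {..<n}"
    and "\<And>i. i < n \<Longrightarrow> i \<notin> S \<Longrightarrow> A $$ (i, j) = 0"
  shows "Determinant.det A = (\<Sum>i\<in>S. A $$ (i, j) * ((-1) ^ (i + j) * Determinant.det (mat_delete A i j)))"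
  unfolding laplace_expansion_column[OF assms(1,2)] cofactor_def
  by (intro sum.mono_neutral_right) (use assms in auto)

lemma laplace_row_support:
  assumes "(A :: 'a :: comm_ring_1 mat) \<in> carrier_mat n n" "i < n" "S \<subseteq> {..<n}"
    and "\<And>j. j < n \<Longrightarrow> j \<notin> S \<Longrightarrow> A $$ (i, j) = 0"
  shows "Determinant.det A = (\<Sum>j\<in>S. A $$ (i, j) * ((-1) ^ (i + j) * Determinant.det (mat_delete A i j)))"
  unfolding laplace_expansion_row[OF assms(1,2)] cofactor_def
  by (intro sum.mono_neutral_right) (use assms in auto)

lemma det_lower_triangular_prod:
  assumes "(A :: 'a :: comm_ring_1 mat) \<in> carrier_mat n n"
    and "\<And>i j. i < j \<Longrightarrow> j < n \<Longrightarrow> A $$ (i, j) = 0"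
  shows "Determinant.det A = (\<Prod>i<n. A $$ (i, i))"
proof -
  have "Determinant.det A = prod_list (diag_mat A)"
    by (rule det_lower_triangular[OF assms(2,1)])
  then show ?thesis
    using assms(1) by (simp add: diag_mat_def prod.list_conv_set_nth atLeast0LessThan)
qed

definition tridiag :: "(int \<Rightarrow> 'a::comm_ring_1) \<Rightarrow> (int \<Rightarrow> 'a) \<Rightarrow> int \<Rightarrow> nat \<times> nat \<Rightarrow> 'a" where
  "tridiag a b i = (\<lambda>(r, s). if r = s then a (i + int r) else if s = Suc r then 1
     else if r = Suc s then b (i + int r) else 0)"

lemma det_tridiag: "Determinant.det (Matrix.mat k k (tridiag a b i)) = continuant a b i k"
proof (induction a b i k rule: continuant.induct)
  case (2 a b i)
  then show ?case
    by (subst laplace_column_support[where j = 0 and S = "{0}" and n = "Suc 0"])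
      (auto simp: tridiag_def mat_delete_def)
next
  case (3 a b i k)
  let ?A = "Matrix.mat (Suc (Suc k)) (Suc (Suc k)) (tridiag a b i)"
  let ?B = "mat_delete ?A (Suc k) k"
  have 1: "mat_delete ?A (Suc k) (Suc k) = Matrix.mat (Suc k) (Suc k) (tridiag a b i)"
    by (rule eq_matI) (auto simp: mat_delete_def tridiag_def)
  have 2: "mat_delete ?B k k = Matrix.mat k k (tridiag a b i)"
    by (rule eq_matI) (auto simp: mat_delete_def tridiag_def)
  \<comment> \<open>The last column of \<open>?B\<close> is the old last column without its diagonal
    entry; only the superdiagonal 1 survives in it.\<close>
  have B: "Determinant.det ?B = Determinant.det (Matrix.mat k k (tridiag a b i))"
    by (subst laplace_column_support[where j = k and S = "{k}" and n = "Suc k"])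
      (auto simp: 2, auto simp: mat_delete_def tridiag_def)
  have "Determinant.det ?A = a (i + int k + 1) * Determinant.det (mat_delete ?A (Suc k) (Suc k))
      - b (i + int k + 1) * Determinant.det ?B"
    by (subst laplace_row_support[where i = "Suc k" and S = "{k, Suc k}" and n = "Suc (Suc k)"])
      (auto simp: tridiag_def ac_simps)
  then show ?case
    unfolding 1 B 3 by simp
qed simp

text \<open>The replacing column models the last column of the Lax matrix: its corner
  \<open>q\<close> on top, its superdiagonal 1 at the bottom. Deleting the row of that 1 leaves a
  lower triangular matrix whose diagonal consists of superdiagonal ones.\<close>

lemma det_replace_first_col:
  assumes "m \<ge> 2"
  shows "Determinant.det (Matrix.mat m m (\<lambda>(r, s). if s = 0 then (if r = 0 then q else if r = m - 1 then 1 else 0)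
     else tridiag a b i (r, s))) = q * continuant a b (i + 1) (m - 1) + (-1) ^ (m - 1)"
proof -
  let ?A = "Matrix.mat m m (\<lambda>(r, s). if s = 0 then (if r = 0 then q else if r = m - 1 then 1 else 0)
     else tridiag a b i (r, s))"
  have 1: "mat_delete ?A 0 0 = Matrix.mat (m - 1) (m - 1) (tridiag a b (i + 1))"
    by (rule eq_matI) (auto simp: mat_delete_def tridiag_def ac_simps)
  have 2: "Determinant.det (mat_delete ?A (m - 1) 0) = 1"
    by (subst det_lower_triangular_prod[where n = "m - 1"])
      (auto simp: mat_delete_def tridiag_def)
  show ?thesis
    by (subst laplace_column_support[where j = 0 and S = "{0, m - 1}" and n = m])
      (use assms in \<open>auto simp: 1 2[simplified] det_tridiag\<close>)
qed

lemma det_replace_second_col: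
  assumes "m \<ge> 2"
  shows "Determinant.det (Matrix.mat m m (\<lambda>(r, s). if s = 1 then (if r = 0 then q else if r = m - 1 then 1 else 0)
     else tridiag a b i (r, s))) = (-1) ^ m * a i - q * b (i + 1) * continuant a b (i + 2) (m - 2)"
proof -
  let ?A = "Matrix.mat m m (\<lambda>(r, s). if s = 1 then (if r = 0 then q else if r = m - 1 then 1 else 0)
     else tridiag a b i (r, s))"
  let ?B = "mat_delete ?A 0 1"
  let ?C = "mat_delete ?A (m - 1) 1"
  have 1: "mat_delete ?B 0 0 = Matrix.mat (m - 2) (m - 2) (tridiag a b (i + 2))"
    by (rule eq_matI) (auto simp: mat_delete_def tridiag_def ac_simps)
  have B: "Determinant.det ?B = b (i + 1) * continuant a b (i + 2) (m - 2)"
    by (subst laplace_column_support[where j = 0 and S = "{0}" and n = "m - 1"])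
      (use assms in \<open>auto simp: 1[simplified] det_tridiag\<close>, auto simp: mat_delete_def tridiag_def)
  have "Determinant.det ?C = (\<Prod>r<m - 1. ?C $$ (r, r))"
    by (rule det_lower_triangular_prod) (auto simp: mat_delete_def tridiag_def)
  also have "\<dots> = (\<Prod>r<Suc (m - 2). if r = 0 then a i else 1)"
    using assms by (intro prod.cong) (auto simp: mat_delete_def tridiag_def)
  also have "\<dots> = a i"
    by (simp add: prod.lessThan_Suc_shift)
  finally have C: "Determinant.det ?C = a i" .
  have sg: "(-1) ^ m = - ((-1) ^ (m - Suc 0) :: 'a)" using assms by (cases m) auto
  then show ?thesis
    by (subst laplace_column_support[where j = 1 and S = "{0, m - 1}" and n = m])
      (use assms in \<open>auto simp: B[simplified] C[simplified] sg\<close>)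
qed

text \<open>For \<open>m \<ge> 2\<close> the corners \<open>q\<close> and \<open>z\<close> lie
  outside the band. Besides the uncornered determinant there are three contributions: the
  transposition through both corners, and the two full cycles through one corner each, running along
  the superdiagonal ones or along the subdiagonal \<open>b\<close>. The full cycles have sign
  \<open>(-1) ^ m\<close>, which the signs in the corners of the Lax matrix cancel.\<close>

lemma det_cyclic_tridiag:
  assumes "m \<ge> 2"
  shows "Determinant.det (Matrix.mat (m + 1) (m + 1) (\<lambda>(r, s). tridiag a b i (r, s)
       + (if r = 0 \<and> s = m then q else 0) + (if r = m \<and> s = 0 then z else 0)))
     = continuant a b i (m + 1) - q * z * continuant a b (i + 1) (m - 1)
       + (-1) ^ m * (z + q * (\<Prod>j = 1..m. b (i + int j)))"
proof -
  let ?A = "Matrix.mat (m + 1) (m + 1) (\<lambda>(r, s). tridiag a b i (r, s)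
       + (if r = 0 \<and> s = m then q else 0) + (if r = m \<and> s = 0 then z else 0))"
  let ?P = "mat_delete ?A 0 m" and ?Q = "mat_delete ?A (m - 1) m"
  have 1: "mat_delete ?A m m = Matrix.mat m m (tridiag a b i)"
    by (rule eq_matI) (auto simp: mat_delete_def)
  have 2: "mat_delete ?Q (m - 1) (m - 1) = Matrix.mat (m - 1) (m - 1) (tridiag a b i)"
    by (rule eq_matI) (auto simp: mat_delete_def)
  have 3: "Determinant.det (mat_delete ?Q (m - 1) 0) = 1"
    by (subst det_lower_triangular_prod[where n = "m - 1"])
      (use assms in \<open>auto simp: mat_delete_def tridiag_def intro!: prod.neutral\<close>)
  have A1: "Determinant.det ?Q = (-1) ^ (m - 1) * z + b (i + int m) * continuant a b i (m - 1)"
  proof -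
    have "Determinant.det ?Q = (\<Sum>s\<in>{0, m - 1}. ?Q $$ (m - 1, s) * ((-1) ^ (m - 1 + s) * Determinant.det (mat_delete ?Q (m - 1) s)))"
      by (rule laplace_row_support[where n = m])
        (use assms in \<open>auto simp: mat_delete_def tridiag_def\<close>)
    moreover have "?Q $$ (m - 1, 0) = z" "?Q $$ (m - 1, m - 1) = b (i + int m)"
      using assms by (auto simp: mat_delete_def tridiag_def)
    ultimately show ?thesis using assms 2 3 det_tridiag[of "m - 1" a b i]
      by (simp add: ac_simps)
  qed
  have 4: "mat_delete ?P (m - 1) 0 = Matrix.mat (m - 1) (m - 1) (tridiag a b (i + 1))"
    by (rule eq_matI) (use assms in \<open>auto simp: mat_delete_def tridiag_def ac_simps\<close>)
  have 5: "Determinant.det (mat_delete ?P 0 0) = (\<Prod>j = 2..m. b (i + int j))"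
  proof -
    let ?B = "mat_delete ?P 0 0"
    have "Determinant.det (transpose_mat ?B) = (\<Prod>r<m - 1. transpose_mat ?B $$ (r, r))"
      by (rule det_lower_triangular_prod) (auto simp: mat_delete_def tridiag_def)
    also have "Determinant.det (transpose_mat ?B) = Determinant.det ?B"
      by (rule det_transpose[where n = "m - 1"]) (auto simp: mat_delete_def)
    also have "(\<Prod>r<m - 1. transpose_mat ?B $$ (r, r)) = (\<Prod>r<m - 1. b (i + int (r + 2)))"
      by (rule prod.cong) (auto simp: mat_delete_def tridiag_def)
    also have "\<dots> = (\<Prod>j = 2..m. b (i + int j))"
      by (rule prod.reindex_bij_witness[of _ "\<lambda>j. j - 2" "\<lambda>j. j + 2"]) auto
    finally show ?thesis .
  qed
  have A0: "Determinant.det ?P = (\<Prod>j = 1..m. b (i + int j)) + (-1) ^ (m - 1) * z * continuant a b (i + 1) (m - 1)"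
  proof -
    have "Determinant.det ?P = (\<Sum>r\<in>{0, m - 1}. ?P $$ (r, 0) * ((-1) ^ (r + 0) * Determinant.det (mat_delete ?P r 0)))"
      by (rule laplace_column_support[where n = m])
        (use assms in \<open>auto simp: mat_delete_def tridiag_def\<close>)
    moreover have "?P $$ (m - 1, 0) = z" "?P $$ (0, 0) = b (i + 1)"
      using assms by (auto simp: mat_delete_def tridiag_def)
    moreover have "(\<Prod>j = 1..m. b (i + int j)) = b (i + 1) * (\<Prod>j = 2..m. b (i + int j))"
      using assms by (subst prod.atLeast_Suc_atMost) (auto simp: numeral_2_eq_2)
    ultimately show ?thesis using assms 4 5 det_tridiag[of "m - 1" a b "i + 1"]
      by (simp add: ac_simps)
  qed
  have "Determinant.det ?A = (\<Sum>r\<in>{0, m - 1, m}. ?A $$ (r, m) * ((-1) ^ (r + m) * Determinant.det (mat_delete ?A r m)))"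
    by (rule laplace_column_support[where n = "m + 1"])
      (use assms in \<open>auto simp: tridiag_def\<close>)
  also have "\<dots> = q * (-1) ^ m * Determinant.det ?P - Determinant.det ?Q + a (i + int m) * continuant a b i m"
  proof -
    have "?A $$ (0, m) = q" "?A $$ (m - 1, m) = 1" "?A $$ (m, m) = a (i + int m)"
      using assms by (auto simp: tridiag_def)
    moreover have "(-1 :: 'a) ^ (m - 1 + m) = -1" "(-1 :: 'a) ^ (m + m) = 1" using assms by auto
    ultimately show ?thesis using assms 1 det_tridiag[of m a b i] by simp
  qed
  also have "\<dots> = continuant a b i (m + 1) - q * z * continuant a b (i + 1) (m - 1)
       + (-1) ^ m * (z + q * (\<Prod>j = 1..m. b (i + int j)))"
  proof -
    obtain k where "m = Suc k" using assms by (cases m) auto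
    moreover have "(-1) ^ k * ((-1) ^ k * z) = z" for z :: 'a
      by (simp add: mult.assoc[symmetric] power_mult_distrib[symmetric])
    ultimately show ?thesis unfolding A0 A1 by (simp add: algebra_simps del: prod.cl_ivl_Suc)
  qed
  finally show ?thesis .
qed

section \<open>Orders of meromorphic functions\<close>

text \<open>A relation rather than the value \<open>zorder\<close>: it also asserts that the
  function is meromorphic at 0 and not identically zero nearby, so products and quotients need no
  side conditions.\<close>

definition has_order :: "(complex \<Rightarrow> complex) \<Rightarrow> int \<Rightarrow> bool" where
  "has_order f k \<longleftrightarrow> (\<exists>h. h analytic_on {0} \<and> h 0 \<noteq> 0 \<and> (\<forall>\<^sub>F t in at 0. f t = h t * t powi k))"

lemma has_orderI:
  assumes "h analytic_on {0}" "h 0 \<noteq> 0" "\<forall>\<^sub>F t in at 0. f t = h t * t powi k"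
  shows "has_order f k"
  using assms unfolding has_order_def by blast

lemma has_order_zorder:
  assumes "has_order f k"
  shows "zorder f 0 = k"
proof -
  obtain h where h: "h analytic_on {0}" "h 0 \<noteq> 0" and ev: "\<forall>\<^sub>F t in at 0. f t = h t * t powi k"
    using assms unfolding has_order_def by blast
  from h(1) obtain S where S: "open S" "0 \<in> S" "h holomorphic_on S"
    using analytic_at by blast
  from ev obtain T where T: "open T" "0 \<in> T" "\<And>t. t \<in> T \<Longrightarrow> t \<noteq> 0 \<Longrightarrow> f t = h t * t powi k"
    unfolding eventually_at_topological by auto
  show ?thesis
    by (rule zorder_eqI[of "S \<inter> T" _ h])
      (use S T h in \<open>auto intro: holomorphic_on_subset\<close>)
qed

lemma has_order_unique: "has_order f k \<Longrightarrow> has_order f l \<Longrightarrow> k = l"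
  using has_order_zorder by blast

lemma has_order_nonzero:
  assumes "has_order f k"
  shows "\<forall>\<^sub>F t in at 0. f t \<noteq> 0"
proof -
  obtain h where h: "h analytic_on {0}" "h 0 \<noteq> 0" and ev: "\<forall>\<^sub>F t in at 0. f t = h t * t powi k"
    using assms unfolding has_order_def by blast
  have "\<forall>\<^sub>F t in at 0. h t \<noteq> 0" using h by (rule analytic_at_neq_imp_eventually_neq)
  moreover have "\<forall>\<^sub>F t in at 0. t \<noteq> (0::complex)" by (simp add: eventually_at_filter)
  ultimately show ?thesis using ev by eventually_elim auto
qed

lemma has_order_cong:
  assumes "has_order f k" "\<forall>\<^sub>F t in at 0. g t = f t"
  shows "has_order g k"
proof -
  obtain h where h: "h analytic_on {0}" "h 0 \<noteq> 0" and ev: "\<forall>\<^sub>F t in at 0. f t = h t * t powi k"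
    using assms unfolding has_order_def by blast
  show ?thesis using h by (rule has_orderI) (use ev assms(2) in eventually_elim, simp)
qed

lemma has_order_mult:
  assumes "has_order f k" "has_order g l"
  shows "has_order (\<lambda>t. f t * g t) (k + l)"
proof -
  obtain h h' where h: "h analytic_on {0}" "h 0 \<noteq> 0" "\<forall>\<^sub>F t in at 0. f t = h t * t powi k"
    and h': "h' analytic_on {0}" "h' 0 \<noteq> 0" "\<forall>\<^sub>F t in at 0. g t = h' t * t powi l"
    using assms unfolding has_order_def by blast
  have nz: "\<forall>\<^sub>F t in at 0. t \<noteq> (0::complex)" by (simp add: eventually_at_filter)
  show ?thesis
  proof (rule has_orderI)
    show "(\<lambda>t. h t * h' t) analytic_on {0}" "h 0 * h' 0 \<noteq> 0"
      using h h' by (auto intro: analytic_intros)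
    show "\<forall>\<^sub>F t in at 0. f t * g t = h t * h' t * t powi (k + l)"
      using h(3) h'(3) nz by eventually_elim (simp add: power_int_add)
  qed
qed

lemma has_order_inverse:
  assumes "has_order f k"
  shows "has_order (\<lambda>t. inverse (f t)) (- k)"
proof -
  obtain h where h: "h analytic_on {0}" "h 0 \<noteq> 0" and ev: "\<forall>\<^sub>F t in at 0. f t = h t * t powi k"
    using assms unfolding has_order_def by blast
  show ?thesis
  proof (rule has_orderI)
    show "(\<lambda>t. inverse (h t)) analytic_on {0}" "inverse (h 0) \<noteq> 0"
      using h by (auto intro: analytic_intros)
    show "\<forall>\<^sub>F t in at 0. inverse (f t) = inverse (h t) * t powi (- k)"
      using ev by eventually_elim (simp add: power_int_minus)
  qed
qed

lemma has_order_divide: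
  assumes "has_order f k" "has_order g l"
  shows "has_order (\<lambda>t. f t / g t) (k - l)"
  using has_order_mult[OF assms(1) has_order_inverse[OF assms(2)]] by (simp add: divide_inverse)

lemma has_order_0: "f analytic_on {0} \<Longrightarrow> f 0 \<noteq> 0 \<Longrightarrow> has_order f 0"
  by (rule has_orderI) auto

lemma has_order_power: "has_order f k \<Longrightarrow> has_order (\<lambda>t. f t ^ n) (int n * k)"
proof (induction n)
  case 0
  then show ?case by (auto intro: has_order_0)
next
  case (Suc n)
  then show ?case using has_order_mult[OF Suc.prems Suc.IH[OF Suc.prems]] by (simp add: distrib_right)
qed

lemma has_order_meromorphic:
  assumes "f meromorphic_on {0}" "\<exists>\<^sub>F t in at 0. f t \<noteq> 0"
  shows "has_order f (zorder f 0)"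
proof -
  obtain r where r: "zor_poly f 0 0 \<noteq> 0" "r > 0" "zor_poly f 0 holomorphic_on cball 0 r"
    "\<And>w. w \<in> cball 0 r - {0} \<Longrightarrow> f w = zor_poly f 0 w * w powi zorder f 0"
    using zorder_exist[of f 0] assms unfolding meromorphic_at_iff by auto
  show ?thesis
  proof (rule has_orderI)
    show "zor_poly f 0 analytic_on {0}"
      using r(2,3) by (meson analytic_at_ball ball_subset_cball holomorphic_on_subset)
    show "\<forall>\<^sub>F t in at 0. f t = zor_poly f 0 t * t powi zorder f 0"
      using r(2,4) unfolding eventually_at by (intro exI[of _ r]) auto
  qed (use r in auto)
qed

lemma has_order_1:
  assumes "f analytic_on {0}" "f 0 = 0" "deriv f 0 \<noteq> 0"
  shows "has_order f 1"
proof -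
  have "\<exists>\<^sub>F t in at 0. f t \<noteq> 0"
  proof (rule ccontr)
    assume "\<not> ?thesis"
    then have "\<forall>\<^sub>F t in at 0. f t = 0" by (simp add: frequently_def)
    then have "\<forall>\<^sub>F t in nhds 0. f t = (\<lambda>_. 0) t"
      using assms(2) by (auto simp: eventually_nhds_conv_at)
    then have "deriv f 0 = 0" using deriv_cong_ev[of f "\<lambda>_. 0" 0 0] by simp
    then show False using assms by simp
  qed
  moreover have "zorder f 0 = 1"
    by (rule zorder_zero_eqI') (use assms in auto)
  ultimately show ?thesis
    using has_order_meromorphic[of f] analytic_on_imp_meromorphic_on[OF assms(1)] by simp
qed

lemma analytic_on_poly [analytic_intros]:
  fixes x :: "complex \<Rightarrow> complex"
  shows "x analytic_on S \<Longrightarrow> (\<lambda>t. poly p (x t)) analytic_on S"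
  by (induction p) (auto intro!: analytic_intros)

lemma meromorphic_on_poly [meromorphic_intros]:
  fixes x :: "complex \<Rightarrow> complex"
  shows "x meromorphic_on S \<Longrightarrow> (\<lambda>t. poly p (x t)) meromorphic_on S"
  by (induction p) (auto intro!: meromorphic_intros)

lemma has_order_poly:
  assumes "x analytic_on {0}" "x 0 = a" "has_order (\<lambda>t. x t - a) e" "p \<noteq> 0"
  shows "has_order (\<lambda>t. poly p (x t)) (int (Polynomial.order a p) * e)"
proof -
  obtain q where q: "p = [:-a, 1:] ^ Polynomial.order a p * q" "\<not> [:-a, 1:] dvd q"
    using order_decomp[OF assms(4)] by blast
  have "poly q a \<noteq> 0" using q(2) poly_eq_0_iff_dvd by blast
  then have "has_order (\<lambda>t. poly q (x t)) 0"
    using assms(1,2) by (intro has_order_0 analytic_intros) auto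
  from has_order_mult[OF has_order_power[OF assms(3), of "Polynomial.order a p"] this]
  show ?thesis by (subst q(1)) simp
qed

section \<open>Local parametrizations of the spectral curve\<close>

lemma aff_param_deriv:
  assumes "aff_param F x y"
  shows "2 * y 0 * deriv y 0 = poly (pderiv F) (x 0) * deriv x 0"
proof -
  have x: "(x has_field_derivative deriv x 0) (at 0)" and y: "(y has_field_derivative deriv y 0) (at 0)"
    using assms analytic_on_imp_differentiable_at[of _ "{0}" 0] DERIV_deriv_iff_field_differentiable
    unfolding aff_param_def by blast+
  have "((\<lambda>t. y t ^ 2) has_field_derivative 2 * y 0 * deriv y 0) (at 0)"
    using y by (auto intro!: derivative_eq_intros)
  moreover have "((\<lambda>t. poly F (x t)) has_field_derivative poly (pderiv F) (x 0) * deriv x 0) (at 0)"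
    using DERIV_chain2[OF poly_DERIV x] .
  moreover have "deriv (\<lambda>t. y t ^ 2) 0 = deriv (\<lambda>t. poly F (x t)) 0"
    using assms unfolding aff_param_def by (intro deriv_cong_ev) auto
  ultimately show ?thesis by (simp add: DERIV_imp_deriv)
qed

lemma aff_param_at_0:
  assumes "aff_param F x y"
  shows "y 0 ^ 2 = poly F (x 0)"
  using assms unfolding aff_param_def by (auto dest: eventually_nhds_x_imp_x)

lemma has_order_deriv_nonzero:
  assumes "x analytic_on {0}" "deriv x 0 \<noteq> 0"
  shows "has_order (\<lambda>t. x t - x 0) 1"
proof (rule has_order_1)
  have "x field_differentiable at 0"
    using assms(1) analytic_on_imp_differentiable_at by blast
  then have "deriv (\<lambda>t. x t - x 0) 0 = deriv x 0"
    by (simp add: deriv_diff)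
  then show "deriv (\<lambda>t. x t - x 0) 0 \<noteq> 0" using assms by simp
qed (use assms in \<open>auto intro!: analytic_intros\<close>)

text \<open>The differentiated equation \<open>2 y y' = F'(x) x'\<close> decides which function is a
  local coordinate. Where \<open>y\<close> is nonzero it is \<open>x\<close>; at a branch point it
  is \<open>y\<close>, and \<open>x - a = y^2 / q(x)\<close> with \<open>F = (X - a) q\<close> has
  order two.\<close>

lemma aff_param_order_x:
  assumes "aff_param F x y" "poly (pderiv F) (x 0) \<noteq> 0 \<or> y 0 \<noteq> 0"
  shows "has_order (\<lambda>t. x t - x 0) (if y 0 = 0 then 2 else 1)"
proof (cases "y 0 = 0")
  case False
  then have "deriv x 0 \<noteq> 0"
    using aff_param_deriv[OF assms(1)] assms(1) unfolding aff_param_def by auto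
  then show ?thesis using False has_order_deriv_nonzero assms(1) unfolding aff_param_def by auto
next
  case True
  let ?a = "x 0"
  have "poly F ?a = 0" using aff_param_at_0[OF assms(1)] True by simp
  then have "[:-?a, 1:] dvd F" by (simp only: poly_eq_0_iff_dvd)
  then obtain q where q: "F = [:-?a, 1:] * q" by (rule dvdE)
  have "poly (pderiv F) ?a = poly q ?a"
    by (subst q) (simp add: pderiv_mult pderiv_pCons del: mult_pCons_left)
  then have qa: "poly q ?a \<noteq> 0"
    using assms(2) True by simp
  have x: "x analytic_on {0}" and y: "y analytic_on {0}" using assms(1) by (auto simp: aff_param_def)
  have "deriv y 0 \<noteq> 0"
    using aff_param_deriv[OF assms(1)] assms True unfolding aff_param_def by auto
  then have "has_order y 1" using has_order_1[OF y] True by simp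
  moreover have "has_order (\<lambda>t. poly q (x t)) 0"
    using x qa by (intro has_order_0 analytic_intros) auto
  ultimately have "has_order (\<lambda>t. y t ^ 2 / poly q (x t)) 2"
    using has_order_divide[OF has_order_power[of y 1 2], of _ 0] by simp
  moreover have "\<forall>\<^sub>F t in at 0. x t - x 0 = y t ^ 2 / poly q (x t)"
  proof -
    have "\<forall>\<^sub>F t in at 0. poly q (x t) \<noteq> 0"
      using \<open>has_order (\<lambda>t. poly q (x t)) 0\<close> by (rule has_order_nonzero)
    moreover have "\<forall>\<^sub>F t in at 0. y t ^ 2 = poly F (x t)"
      using assms(1) unfolding aff_param_def by (auto simp: eventually_nhds_conv_at)
    ultimately show ?thesis by eventually_elim (simp add: q[THEN arg_cong[of _ _ "\<lambda>p. poly p _"]] field_simps)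
  qed
  ultimately show ?thesis using True has_order_cong by simp
qed

text \<open>The order of \<open>p(u)\<close> at a point, for nonzero \<open>p\<close>. The factor 2
  is the ramification index of \<open>(u, v) -> u\<close> at a branch point; the two points at
  infinity are unramified.\<close>

fun poly_order :: "complex poly \<Rightarrow> point \<Rightarrow> int" where
  "poly_order p (Aff a b) = int (Polynomial.order a p) * (if b = 0 then 2 else 1)"
| "poly_order p _ = - int (degree p)"

context
  fixes g :: nat and c :: "int \<Rightarrow> complex"
begin

lemma degree_spec_poly: "degree (spec_poly g c) = g + 1" and lead_coeff_spec_poly: "coeff (spec_poly g c) (g + 1) = 1"
proof -
  have lt: "degree (\<Sum>i = 0..g. Polynomial.monom (c (int i)) i) < g + 1"
    by (intro le_less_trans[OF degree_sum_le[of _ _ g]])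
      (auto intro: order.trans[OF degree_monom_le])
  then show "degree (spec_poly g c) = g + 1"
    unfolding spec_poly_def by (subst degree_add_eq_left) (auto simp: degree_monom_eq)
  show "coeff (spec_poly g c) (g + 1) = 1"
    using lt coeff_eq_0 unfolding spec_poly_def by auto
qed

lemma degree_curve_poly: "degree (curve_poly g c) = 2 * (g + 1)"
  and lead_coeff_curve_poly: "lead_coeff (curve_poly g c) = 1"
proof -
  have sq: "degree (spec_poly g c ^ 2) = 2 * (g + 1)"
    by (subst degree_power_eq) (use degree_spec_poly in auto)
  show *: "degree (curve_poly g c) = 2 * (g + 1)"
    unfolding curve_poly_def diff_conv_add_uminus by (subst degree_add_eq_left) (auto simp: sq)
  have "lead_coeff (spec_poly g c ^ 2) = 1"
    unfolding lead_coeff_power degree_spec_poly lead_coeff_spec_poly by simp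
  then show "lead_coeff (curve_poly g c) = 1"
    unfolding * by (simp add: curve_poly_def sq)
qed

lemma curve_poly_nonzero: "curve_poly g c \<noteq> 0"
  using lead_coeff_curve_poly by auto

text \<open>Nonsingularity makes every root of \<open>F\<close> simple. At such a root the order of
  the right side would be odd, that of the left side even. This is the form in which irreducibility
  of the curve enters.\<close>

lemma not_square_times:
  assumes ns: "nonsingular_curve g c" and eq: "A ^ 2 = B ^ 2 * curve_poly g c"
  shows "B = 0"
proof (rule ccontr)
  assume B: "B \<noteq> 0"
  let ?F = "curve_poly g c"
  obtain a where a: "poly ?F a = 0"
    using alg_closed_imp_poly_has_root[of ?F] degree_curve_poly by auto
  have "poly (pderiv ?F) a \<noteq> 0"
    using ns a unfolding nonsingular_curve_def by force
  then have o: "Polynomial.order a ?F = 1"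
    using a curve_poly_nonzero order_pderiv[of ?F a] order_root[of ?F a] order_root[of "pderiv ?F" a] by auto
  have "B ^ 2 * ?F \<noteq> 0" using B curve_poly_nonzero by simp
  moreover from this have "A \<noteq> 0" using eq by auto
  ultimately have "2 * Polynomial.order a A = 2 * Polynomial.order a B + 1"
    using arg_cong[OF eq, of "Polynomial.order a"] B curve_poly_nonzero o
    by (simp add: power2_eq_square order_mult)
  then show False by presburger
qed

text \<open>Away from branch points take \<open>u = a + t\<close> and
  \<open>v = b * csqrt (F(a + t) / b^2)\<close>, analytic because the radicand is near 1. At a
  branch point take \<open>v = t\<close>, with \<open>u\<close> the local inverse of
  \<open>F\<close> at \<open>t^2\<close>. At infinity the first recipe applies to the reflected
  polynomial, whose value at 0 is 1 because \<open>F\<close> is monic.\<close>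

lemma local_param_exists:
  assumes ns: "nonsingular_curve g c" and P: "P \<in> gam g c"
  shows "\<exists>x y. local_param g c P x y"
proof -
  let ?F = "curve_poly g c"
  have sqrt_param: "aff_param F (\<lambda>t. a + t) (\<lambda>t. b * csqrt (poly F (a + t) / b ^ 2))"
    if "b \<noteq> 0" "b ^ 2 = poly F a" for F :: "complex poly" and a b
  proof -
    have "(\<lambda>t. a + t) analytic_on {0}" by (intro analytic_intros)
    moreover have "(\<lambda>t. b * csqrt (poly F (a + t) / b ^ 2)) analytic_on {0}"
      using that by (intro analytic_intros) (auto simp: that(2)[symmetric])
    moreover have "deriv (\<lambda>t. a + t) 0 = 1" by simp
    ultimately show ?thesis
      using that unfolding aff_param_def by (auto simp: power_mult_distrib)
  qed
  show ?thesis
  proof (cases P)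
    case (Aff a b)
    then have on: "b ^ 2 = poly ?F a" using P by (auto simp: gam_def)
    show ?thesis
    proof (cases "b = 0")
      case False
      have "b * csqrt (poly ?F (a + 0) / b ^ 2) = b"
        using False by (simp add: on[symmetric])
      then have "local_param g c P (\<lambda>t. a + t) (\<lambda>t. b * csqrt (poly ?F (a + t) / b ^ 2))"
        unfolding Aff local_param.simps by (intro conjI sqrt_param[OF False on]) simp_all
      then show ?thesis by blast
    next
      case True
      then have F0: "poly ?F a = 0" using on by simp
      have F': "deriv (poly ?F) a \<noteq> 0"
        using ns F0 unfolding nonsingular_curve_def by (force simp: DERIV_imp_deriv[OF poly_DERIV])
      have hol: "poly ?F holomorphic_on S" for S
        by (rule analytic_imp_holomorphic) (intro analytic_intros)
      obtain r where r: "r > 0" "open (poly ?F ` ball a r)" "inj_on (poly ?F) (ball a r)"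
        using has_complex_derivative_locally_invertible[OF hol UNIV_I open_UNIV F'] by metis
      obtain h where h: "h holomorphic_on poly ?F ` ball a r" "\<And>z. z \<in> ball a r \<Longrightarrow> h (poly ?F z) = z"
        using holomorphic_has_inverse[OF hol open_ball r(3)] by metis
      have 0: "0 \<in> poly ?F ` ball a r" using F0 r(1) by (metis centre_in_ball image_eqI)
      have "h analytic_on {0}" using h(1) r(2) 0 by (meson analytic_at)
      moreover have "(\<lambda>t::complex. t ^ 2) analytic_on {0}" by (intro analytic_intros)
      ultimately have "(\<lambda>t. h (t ^ 2)) analytic_on {0}"
        using analytic_on_compose[of "\<lambda>t. t ^ 2" "{0}" h] by (simp add: o_def)
      moreover have "\<forall>\<^sub>F t in nhds 0. t ^ 2 = poly ?F (h (t ^ 2))"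
      proof -
        have "open ((\<lambda>t::complex. t ^ 2) -` (poly ?F ` ball a r))"
          using r(2) by (intro open_vimage continuous_intros)
        then have "\<forall>\<^sub>F t in nhds 0. t \<in> (\<lambda>t::complex. t ^ 2) -` (poly ?F ` ball a r)"
          using 0 by (intro eventually_nhds_in_open) auto
        then show ?thesis
        proof eventually_elim
          case (elim t)
          then obtain z where "z \<in> ball a r" "t ^ 2 = poly ?F z" by blast
          then show ?case using h(2) by simp
        qed
      qed
      moreover have "h 0 = a" using h(2)[of a] F0 r(1) by simp
      ultimately have "local_param g c P (\<lambda>t. h (t ^ 2)) (\<lambda>t. t)"
        using True by (auto simp: Aff aff_param_def intro!: analytic_intros)
      then show ?thesis by blast
    qed
  next
    case PInf
    let ?w = "\<lambda>t. 1 * csqrt (poly (reflect_poly ?F) (0 + t) / 1 ^ 2)"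
    have "aff_param (reflect_poly ?F) (\<lambda>t. 0 + t) ?w"
      by (rule sqrt_param) (auto simp: lead_coeff_curve_poly)
    then have "inf_param g c 1 (\<lambda>t. 1 / (0 + t)) (\<lambda>t. ?w t / (0 + t) ^ (g + 1))"
      unfolding inf_param_def
      by (intro exI[of _ "\<lambda>t. 0 + t"] exI[of _ ?w]) (auto simp: lead_coeff_curve_poly)
    then show ?thesis unfolding PInf by auto
  next
    case PInf'
    let ?w = "\<lambda>t. - 1 * csqrt (poly (reflect_poly ?F) (0 + t) / (-1) ^ 2)"
    have "aff_param (reflect_poly ?F) (\<lambda>t. 0 + t) ?w"
      by (rule sqrt_param) (auto simp: lead_coeff_curve_poly)
    then have "inf_param g c (-1) (\<lambda>t. 1 / (0 + t)) (\<lambda>t. ?w t / (0 + t) ^ (g + 1))"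
      unfolding inf_param_def
      by (intro exI[of _ "\<lambda>t. 0 + t"] exI[of _ ?w]) (auto simp: lead_coeff_curve_poly)
    then show ?thesis unfolding PInf' by auto
  qed
qed

lemma inf_paramE:
  assumes "inf_param g c w0 x y" "w0 ^ 2 = 1"
  obtains s w where "s analytic_on {0}" "w analytic_on {0}" "has_order s 1" "s 0 = 0" "w 0 = w0"
    "x = (\<lambda>t. 1 / s t)" "y = (\<lambda>t. w t / s t ^ (g + 1))"
    "\<forall>\<^sub>F t in at 0. w t ^ 2 = poly (reflect_poly (curve_poly g c)) (s t)"
proof -
  obtain s w where sw: "aff_param (reflect_poly (curve_poly g c)) s w" "s 0 = 0" "w 0 = w0"
    "x = (\<lambda>t. 1 / s t)" "y = (\<lambda>t. w t / s t ^ (g + 1))"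
    using assms(1) unfolding inf_param_def by blast
  have "w0 \<noteq> 0" using assms(2) by auto
  then have "has_order s 1"
    using aff_param_order_x[OF sw(1)] sw by simp
  then show ?thesis
    using that[of s w] sw by (auto simp: aff_param_def eventually_nhds_conv_at)
qed

lemma has_order_poly_inverse:
  assumes "s analytic_on {0}" "has_order s 1" "s 0 = 0" "p \<noteq> 0"
  shows "has_order (\<lambda>t. poly p (1 / s t)) (- int (degree p))"
proof -
  have "has_order (\<lambda>t. poly (reflect_poly p) (s t)) 0"
    using assms by (intro has_order_0 analytic_intros) auto
  from has_order_divide[OF this has_order_power[OF assms(2), of "degree p"]]
  have "has_order (\<lambda>t. poly (reflect_poly p) (s t) / s t ^ degree p) (- int (degree p))" by simp
  moreover have "\<forall>\<^sub>F t in at 0. poly p (1 / s t) = poly (reflect_poly p) (s t) / s t ^ degree p"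
    using has_order_nonzero[OF assms(2)]
    by eventually_elim (simp add: poly_reflect_poly_nz inverse_eq_divide)
  ultimately show ?thesis by (rule has_order_cong)
qed

lemma local_param_curve:
  assumes "P \<in> gam g c" "local_param g c P x y"
  shows "\<forall>\<^sub>F t in at 0. y t ^ 2 = poly (curve_poly g c) (x t)"
    and "x meromorphic_on {0}" "y meromorphic_on {0}"
proof -
  let ?F = "curve_poly g c"
  have inf: "(\<forall>\<^sub>F t in at 0. y t ^ 2 = poly ?F (x t)) \<and> x meromorphic_on {0} \<and> y meromorphic_on {0}"
    if xy: "inf_param g c w0 x y" "w0 ^ 2 = 1" for w0
  proof -
    obtain s w where sw: "s analytic_on {0}" "w analytic_on {0}" "has_order s 1" "s 0 = 0" "w 0 = w0"
      "x = (\<lambda>t. 1 / s t)" "y = (\<lambda>t. w t / s t ^ (g + 1))"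
      "\<forall>\<^sub>F t in at 0. w t ^ 2 = poly (reflect_poly ?F) (s t)"
      by (rule inf_paramE[OF xy])
    have "\<forall>\<^sub>F t in at 0. y t ^ 2 = poly ?F (x t)"
      using sw(8) has_order_nonzero[OF sw(3)]
    proof eventually_elim
      case (elim t)
      have "y t ^ 2 = w t ^ 2 / s t ^ (2 * (g + 1))"
        unfolding sw(7) by (simp only: power_divide power_mult[symmetric] mult.commute)
      also have "\<dots> = poly ?F (x t)"
        unfolding elim(1) poly_reflect_poly_nz[OF elim(2)] degree_curve_poly sw(6)
        using elim(2) by (simp add: inverse_eq_divide)
      finally show ?case .
    qed
    moreover have "s meromorphic_on {0}" "w meromorphic_on {0}"
      using sw(1,2) by (auto intro: analytic_on_imp_meromorphic_on)
    ultimately show ?thesis unfolding sw(6,7) by (auto intro!: meromorphic_intros)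
  qed
  have "(\<forall>\<^sub>F t in at 0. y t ^ 2 = poly ?F (x t)) \<and> x meromorphic_on {0} \<and> y meromorphic_on {0}"
    using assms inf[of 1] inf[of "-1"]
    by (cases P) (auto simp: aff_param_def eventually_nhds_conv_at intro: analytic_on_imp_meromorphic_on)
  then show "\<forall>\<^sub>F t in at 0. y t ^ 2 = poly ?F (x t)" "x meromorphic_on {0}" "y meromorphic_on {0}" by auto
qed

lemma local_param_order_poly:
  assumes ns: "nonsingular_curve g c" and P: "P \<in> gam g c" and xy: "local_param g c P x y" and p: "p \<noteq> 0"
  shows "has_order (\<lambda>t. poly p (x t)) (poly_order p P)"
proof -
  have inf: "has_order (\<lambda>t. poly p (x t)) (- int (degree p))"
    if "inf_param g c w0 x y" "w0 ^ 2 = 1" for w0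
    using inf_paramE[OF that] has_order_poly_inverse[OF _ _ _ p] by metis
  show ?thesis
  proof (cases P)
    case (Aff a b)
    then have *: "aff_param (curve_poly g c) x y" "x 0 = a" "y 0 = b" using xy by auto
    have "poly (pderiv (curve_poly g c)) a \<noteq> 0 \<or> b \<noteq> 0"
      using ns P Aff unfolding nonsingular_curve_def gam_def by auto
    then have "has_order (\<lambda>t. x t - a) (if b = 0 then 2 else 1)"
      using aff_param_order_x[OF *(1)] * by simp
    then show ?thesis
      using has_order_poly[where x = x and a = a and p = p] * p unfolding Aff aff_param_def by simp
  qed (use xy inf[of 1] inf[of "-1"] in auto)
qed

end

section \<open>Orders of rational functions on the curve\<close>

lemma poly_uv_0 [simp]: "poly_uv 0 u v = 0"
  and poly_uv_1 [simp]: "poly_uv 1 u v = 1"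
  and poly_uv_pCons [simp]: "poly_uv (pCons a N) u v = poly a u + v * poly_uv N u v"
  and poly_uv_mult [simp]: "poly_uv (N * M) u v = poly_uv N u v * poly_uv M u v"
  by (simp_all add: poly_uv_def)

text \<open>The norm of \<open>S(u) + v / 2\<close> under \<open>v -> - v\<close>, after replacing
  \<open>v^2\<close> by \<open>F(u)\<close>.\<close>

definition norm_poly :: "nat \<Rightarrow> (int \<Rightarrow> complex) \<Rightarrow> complex poly \<Rightarrow> complex poly" where
  "norm_poly g c S = S ^ 2 - Polynomial.smult (1 / 4) (curve_poly g c)"

context
  fixes g :: nat and c :: "int \<Rightarrow> complex"
  assumes ns: "nonsingular_curve g c"
begin

lemma poly_uv_reduce:
  "\<exists>A B. \<forall>u v. v ^ 2 = poly (curve_poly g c) u \<longrightarrow> poly_uv N u v = poly A u + poly B u * v"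
proof (induction N)
  case 0
  then show ?case by (intro exI[of _ 0]) simp
next
  case (pCons a N)
  then obtain A B where AB: "\<forall>u v. v ^ 2 = poly (curve_poly g c) u \<longrightarrow> poly_uv N u v = poly A u + poly B u * v"
    by blast
  show ?case
  proof (rule exI[of _ "a + B * curve_poly g c"], rule exI[of _ A], intro allI impI)
    fix u v assume on: "v ^ 2 = poly (curve_poly g c) u"
    then show "poly_uv (pCons a N) u v = poly (a + B * curve_poly g c) u + poly A u * v"
      using AB by (simp add: algebra_simps power2_eq_square flip: on)
  qed
qed

text \<open>A function that is nonzero at one point of the curve cannot vanish identically near
  another: on the curve it is \<open>A + B v\<close>, and local vanishing would force
  \<open>A^2 = B^2 F\<close>, hence \<open>A = B = 0\<close>. This replaces an identity theorem on a
  connected surface.\<close>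

lemma nonzero_on_curve_has_order:
  assumes P: "P \<in> gam g c" and xy: "local_param g c P x y" and N: "nonzero_on_curve g c N"
  shows "\<exists>k. has_order (\<lambda>t. poly_uv N (x t) (y t)) k"
proof -
  let ?F = "curve_poly g c"
  note xy' = local_param_curve[OF P xy]
  obtain A B where AB: "\<And>u v. v ^ 2 = poly ?F u \<Longrightarrow> poly_uv N u v = poly A u + poly B u * v"
    using poly_uv_reduce by blast
  have "(\<lambda>t. poly_uv N (x t) (y t)) meromorphic_on {0}"
    by (induction N) (auto intro!: meromorphic_intros xy')
  moreover have "\<exists>\<^sub>F t in at 0. poly_uv N (x t) (y t) \<noteq> 0"
  proof (rule ccontr)
    assume "\<not> ?thesis"
    then have "\<forall>\<^sub>F t in at 0. poly_uv N (x t) (y t) = 0" by (simp add: frequently_def)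
    then have ev: "\<forall>\<^sub>F t in at 0. poly (A ^ 2 - B ^ 2 * ?F) (x t) = 0"
      using xy'(1)
    proof eventually_elim
      case (elim t)
      then have "poly A (x t) = - (poly B (x t) * y t)"
        using AB by (simp add: eq_neg_iff_add_eq_0)
      then show ?case using elim by (simp add: power_mult_distrib)
    qed
    have "A ^ 2 - B ^ 2 * ?F = 0"
    proof (rule ccontr)
      assume "A ^ 2 - B ^ 2 * ?F \<noteq> 0"
      then have "\<forall>\<^sub>F t in at 0. poly (A ^ 2 - B ^ 2 * ?F) (x t) \<noteq> 0"
        by (intro has_order_nonzero[OF local_param_order_poly[OF ns P xy]])
      with ev have "\<forall>\<^sub>F t in at (0::complex). False" by eventually_elim simp
      then show False by simp
    qed
    then have "B = 0" "A = 0" using not_square_times[OF ns, of A B] by auto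
    then show False using N AB unfolding nonzero_on_curve_def gam_def by auto
  qed
  ultimately show ?thesis using has_order_meromorphic by blast
qed

lemma ord_at_param:
  assumes "P \<in> gam g c"
  shows "\<exists>x y. local_param g c P x y \<and> (\<forall>f. ord_at g c P f = zorder (\<lambda>t. f (x t) (y t)) 0)"
proof -
  define xy where "xy = (SOME (x, y). local_param g c P x y)"
  obtain x0 y0 where "local_param g c P x0 y0" using local_param_exists[OF ns assms] by blast
  then have "case (x0, y0) of (x, y) \<Rightarrow> local_param g c P x y" by (simp only: prod.case)
  then have "case xy of (x, y) \<Rightarrow> local_param g c P x y" unfolding xy_def by (rule someI)
  moreover have "ord_at g c P f = (case xy of (x, y) \<Rightarrow> zorder (\<lambda>t. f (x t) (y t)) 0)" for f
    unfolding ord_at_def xy_def Let_def ..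
  ultimately show ?thesis
    by (cases xy) auto
qed

text \<open>The parametrization inside \<open>ord_at\<close> is an unspecified choice, so the order
  is asked for under every parametrization.\<close>

lemma ord_at_eqI:
  assumes "P \<in> gam g c" "\<And>x y. local_param g c P x y \<Longrightarrow> has_order (\<lambda>t. f (x t) (y t)) k"
  shows "ord_at g c P f = k"
  using ord_at_param[OF assms(1)] assms(2) has_order_zorder by metis

text \<open>The two witnesses may be different points, possibly zeros of the other factor. Both
  factors have an order at one common point, so their product is nonzero at a nearby one.\<close>

lemma nonzero_on_curve_mult:
  assumes N: "nonzero_on_curve g c N" and M: "nonzero_on_curve g c M"
  shows "nonzero_on_curve g c (N * M)"
proof -
  obtain u v where P: "Aff u v \<in> gam g c" using N unfolding nonzero_on_curve_def by blast
  then obtain x y where xy: "local_param g c (Aff u v) x y" using local_param_exists[OF ns] by blast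
  obtain k l where "has_order (\<lambda>t. poly_uv N (x t) (y t)) k" "has_order (\<lambda>t. poly_uv M (x t) (y t)) l"
    using nonzero_on_curve_has_order[OF P xy] N M by blast
  then have "has_order (\<lambda>t. poly_uv (N * M) (x t) (y t)) (k + l)"
    using has_order_mult by simp
  from has_order_nonzero[OF this] local_param_curve(1)[OF P xy]
  have "\<forall>\<^sub>F t in at 0. poly_uv (N * M) (x t) (y t) \<noteq> 0 \<and> y t ^ 2 = poly (curve_poly g c) (x t)"
    by eventually_elim auto
  then obtain t where "poly_uv (N * M) (x t) (y t) \<noteq> 0" "y t ^ 2 = poly (curve_poly g c) (x t)"
    using eventually_happens'[OF at_neq_bot] by blast
  then show ?thesis unfolding nonzero_on_curve_def gam_def by blast
qed

lemma ord_at_divide: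
  assumes "P \<in> gam g c"
    "nonzero_on_curve g c N" "nonzero_on_curve g c M" "nonzero_on_curve g c N'" "nonzero_on_curve g c M'"
  shows "ord_at g c P (\<lambda>u v. poly_uv (N * N') u v / poly_uv (M * M') u v) =
     ord_at g c P (\<lambda>u v. poly_uv N u v / poly_uv M u v) + ord_at g c P (\<lambda>u v. poly_uv N' u v / poly_uv M' u v)"
    and "ord_at g c P (\<lambda>u v. poly_uv M u v / poly_uv N u v) =
     - ord_at g c P (\<lambda>u v. poly_uv N u v / poly_uv M u v)"
proof -
  obtain x y where xy: "local_param g c P x y" and o: "\<And>f. ord_at g c P f = zorder (\<lambda>t. f (x t) (y t)) 0"
    using ord_at_param[OF assms(1)] by blast
  note ex = nonzero_on_curve_has_order[OF assms(1) xy]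
  obtain n m where nm: "has_order (\<lambda>t. poly_uv N (x t) (y t)) n" "has_order (\<lambda>t. poly_uv M (x t) (y t)) m"
    using ex[OF assms(2)] ex[OF assms(3)] by blast
  obtain n' m' where nm': "has_order (\<lambda>t. poly_uv N' (x t) (y t)) n'" "has_order (\<lambda>t. poly_uv M' (x t) (y t)) m'"
    using ex[OF assms(4)] ex[OF assms(5)] by blast
  note 1 = has_order_divide[OF nm] and 2 = has_order_divide[OF nm'] and 3 = has_order_divide[OF nm(2,1)]
  have 4: "has_order (\<lambda>t. poly_uv (N * N') (x t) (y t) / poly_uv (M * M') (x t) (y t)) ((n - m) + (n' - m'))"
    using has_order_mult[OF 1 2] by simp
  show "ord_at g c P (\<lambda>u v. poly_uv (N * N') u v / poly_uv (M * M') u v) =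
     ord_at g c P (\<lambda>u v. poly_uv N u v / poly_uv M u v) + ord_at g c P (\<lambda>u v. poly_uv N' u v / poly_uv M' u v)"
    unfolding o using 1 2 4 by (simp only: has_order_zorder)
  show "ord_at g c P (\<lambda>u v. poly_uv M u v / poly_uv N u v) =
     - ord_at g c P (\<lambda>u v. poly_uv N u v / poly_uv M u v)"
    unfolding o using 1 3 by (simp add: has_order_zorder)
qed

text \<open>
  The orders of \<open>S(u) + v / 2\<close>: its conjugate \<open>S(u) - v / 2\<close> has no zero in common with it except
  possibly at a branch point, and their product is a polynomial in \<open>u\<close>.
\<close>

lemma norm_poly_nonzero: "norm_poly g c S \<noteq> 0"
proof
  assume "norm_poly g c S = 0"
  then have "(Polynomial.smult 2 S) ^ 2 = 1 ^ 2 * curve_poly g c"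
    by (simp add: norm_poly_def smult_power)
  then have "(1 :: complex poly) = 0" by (rule not_square_times[OF ns])
  then show False by simp
qed

lemma poly_norm_poly:
  assumes "v ^ 2 = poly (curve_poly g c) u"
  shows "poly (norm_poly g c S) u = (poly S u + v / 2) * (poly S u - v / 2)"
  using assms by (simp add: norm_poly_def algebra_simps power2_eq_square)

lemma has_order_conjugate:
  assumes P: "P \<in> gam g c" and xy: "local_param g c P x y"
    and "e ^ 2 = 1" "has_order (\<lambda>t. poly S (x t) - e * y t / 2) l"
  shows "has_order (\<lambda>t. poly S (x t) + e * y t / 2) (poly_order (norm_poly g c S) P - l)"
proof (rule has_order_cong)
  show "has_order (\<lambda>t. poly (norm_poly g c S) (x t) / (poly S (x t) - e * y t / 2)) (poly_order (norm_poly g c S) P - l)"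
    by (intro has_order_divide assms local_param_order_poly[OF ns P xy] norm_poly_nonzero)
  show "\<forall>\<^sub>F t in at 0. poly S (x t) + e * y t / 2 = poly (norm_poly g c S) (x t) / (poly S (x t) - e * y t / 2)"
    using has_order_nonzero[OF assms(4)] local_param_curve(1)[OF P xy]
  proof eventually_elim
    case (elim t)
    then have "(e * y t) ^ 2 = poly (curve_poly g c) (x t)"
      using assms(3) by (simp add: power_mult_distrib)
    from poly_norm_poly[OF this] show ?case using elim by simp
  qed
qed

lemma has_order_linear_Aff:
  assumes P: "Aff a b \<in> gam g c" and xy: "local_param g c (Aff a b) x y"
  shows "has_order (\<lambda>t. poly S (x t) + y t / 2)
    (if poly S a + b / 2 = 0 then int (Polynomial.order a (norm_poly g c S)) else 0)"
proof -
  have x: "x analytic_on {0}" "x 0 = a" and y: "y analytic_on {0}" "y 0 = b"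
    using xy by (auto simp: aff_param_def)
  have 0: "has_order (\<lambda>t. poly S (x t) + e * y t / 2) 0" if "poly S a + e * b / 2 \<noteq> 0" for e
    using that x y by (intro has_order_0 analytic_intros) auto
  consider "poly S a + b / 2 \<noteq> 0" | "poly S a + b / 2 = 0" "b \<noteq> 0" | "poly S a = 0" "b = 0"
    by (cases "b = 0") auto
  then show ?thesis
  proof cases
    case 1
    then show ?thesis using 0[of 1] by simp
  next
    case 2
    then have "poly S a + (-1) * b / 2 \<noteq> 0" by auto
    from 0[OF this] have "has_order (\<lambda>t. poly S (x t) - 1 * y t / 2) 0" by simp
    from has_order_conjugate[OF P xy _ this] show ?thesis using 2 by simp
  next
    \<comment> \<open>At a branch point both conjugates vanish. There \<open>y\<close> is a local
      coordinate and \<open>x\<close> is stationary, so each conjugate has order exactly 1. The norm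
      then has order 2 on the curve, that is, a simple root in \<open>u\<close>, and the formula
      persists.\<close>
    case 3
    have ap: "aff_param (curve_poly g c) x y" using xy by simp
    have F': "poly (pderiv (curve_poly g c)) a \<noteq> 0"
      using ns P 3 unfolding nonsingular_curve_def gam_def by auto
    have dx: "deriv x 0 = 0" using aff_param_deriv[OF ap] F' x y 3 by simp
    then have dy: "deriv y 0 \<noteq> 0" using ap unfolding aff_param_def by auto
    have d: "(x has_field_derivative deriv x 0) (at 0)" "(y has_field_derivative deriv y 0) (at 0)"
      using x(1) y(1) analytic_on_imp_differentiable_at[of _ "{0}" 0] DERIV_deriv_iff_field_differentiable
      by blast+
    have one: "has_order (\<lambda>t. poly S (x t) + e * y t / 2) 1" if "e \<noteq> 0" for e
    proof (rule has_order_1)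
      have "((\<lambda>t. poly S (x t)) has_field_derivative poly (pderiv S) (x 0) * deriv x 0) (at 0)"
        using DERIV_chain2[OF poly_DERIV d(1)] .
      then have "((\<lambda>t. poly S (x t) + e * y t / 2) has_field_derivative e * deriv y 0 / 2) (at 0)"
        using DERIV_add[OF _ DERIV_cdivide[OF DERIV_cmult[OF d(2), of e], of 2]] dx by fastforce
      then show "deriv (\<lambda>t. poly S (x t) + e * y t / 2) 0 \<noteq> 0"
        using dy that by (simp add: DERIV_imp_deriv)
    qed (use x y 3 in \<open>auto intro!: analytic_intros\<close>)
    have o1: "has_order (\<lambda>t. poly S (x t) + y t / 2) 1" using one[of 1] by simp
    have "has_order (\<lambda>t. poly S (x t) - 1 * y t / 2) 1" using one[of "-1"] by simp
    from has_order_conjugate[OF P xy _ this]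
    have "has_order (\<lambda>t. poly S (x t) + y t / 2) (poly_order (norm_poly g c S) (Aff a b) - 1)" by simp
    from has_order_unique[OF o1 this] have "int (Polynomial.order a (norm_poly g c S)) = 1"
      using 3 by simp
    then show ?thesis using o1 3 by simp
  qed
qed

text \<open>At the point with \<open>v / u ^ (g + 1) -> w0\<close> the leading coefficients of
  \<open>S\<close> and of \<open>- w0 * v / 2\<close> are both \<open>-1/2\<close>, so nothing
  cancels. For \<open>w0 = -1\<close> this is \<open>S + v / 2\<close> itself; for
  \<open>w0 = 1\<close> it is the conjugate, and the norm gives the order of
  \<open>S + v / 2\<close>.\<close>

lemma has_order_linear_inf:
  assumes S: "degree S = g + 1" "coeff S (g + 1) = - 1 / 2" and xy: "inf_param g c w0 x y" and w0: "w0 ^ 2 = 1"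
  shows "has_order (\<lambda>t. poly S (x t) - w0 * y t / 2) (- int (g + 1))"
proof -
  obtain s w where sw: "s analytic_on {0}" "w analytic_on {0}" "has_order s 1" "s 0 = 0" "w 0 = w0"
      "x = (\<lambda>t. 1 / s t)" "y = (\<lambda>t. w t / s t ^ (g + 1))"
      "\<forall>\<^sub>F t in at 0. w t ^ 2 = poly (reflect_poly (curve_poly g c)) (s t)"
    by (rule inf_paramE[OF xy w0])
  have "has_order (\<lambda>t. poly (reflect_poly S) (s t) - w0 * w t / 2) 0"
  proof (rule has_order_0)
    show "poly (reflect_poly S) (s 0) - w0 * w 0 / 2 \<noteq> 0"
      using S sw w0 by (simp add: power2_eq_square)
  qed (use sw in \<open>auto intro!: analytic_intros\<close>)
  from has_order_divide[OF this has_order_power[OF sw(3), of "g + 1"]]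
  have "has_order (\<lambda>t. (poly (reflect_poly S) (s t) - w0 * w t / 2) / s t ^ (g + 1)) (- int (g + 1))"
    by simp
  moreover have "\<forall>\<^sub>F t in at 0. poly S (x t) - w0 * y t / 2 = (poly (reflect_poly S) (s t) - w0 * w t / 2) / s t ^ (g + 1)"
    using has_order_nonzero[OF sw(3)]
  proof eventually_elim
    case (elim t)
    then show ?case
      unfolding poly_reflect_poly_nz[OF elim] S(1) sw(6,7) by (simp add: field_simps inverse_eq_divide)
  qed
  ultimately show ?thesis by (rule has_order_cong)
qed

lemma has_order_linear_PInf':
  assumes S: "degree S = g + 1" "coeff S (g + 1) = - 1 / 2" and xy: "local_param g c PInf' x y"
  shows "has_order (\<lambda>t. poly S (x t) + y t / 2) (- int (g + 1))"
  using has_order_linear_inf[OF S, of "-1" x y] xy by simp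

lemma has_order_linear_PInf:
  assumes S: "degree S = g + 1" "coeff S (g + 1) = - 1 / 2" and xy: "local_param g c PInf x y"
  shows "has_order (\<lambda>t. poly S (x t) + y t / 2) (int (g + 1) - int (degree (norm_poly g c S)))"
proof -
  have "has_order (\<lambda>t. poly S (x t) - 1 * y t / 2) (- int (g + 1))"
    using has_order_linear_inf[OF S, of 1 x y] xy by simp
  from has_order_conjugate[OF _ xy _ this] show ?thesis by (simp add: gam_def algebra_simps)
qed

end

section \<open>Divisor classes\<close>

lemma div_degree_eq_sum:
  assumes "finite A" "Poly_Mapping.keys E \<subseteq> A"
  shows "div_degree E = (\<Sum>P\<in>A. Poly_Mapping.lookup E P)"
  unfolding div_degree_def using assms by (intro sum.mono_neutral_left) (auto simp: in_keys_iff)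

lemma div_degree_add [simp]: "div_degree (E + E') = div_degree E + div_degree E'"
proof -
  let ?A = "Poly_Mapping.keys E \<union> Poly_Mapping.keys E'"
  have "Poly_Mapping.keys (E + E') \<subseteq> ?A" by (rule keys_add)
  then show ?thesis
    by (simp add: div_degree_eq_sum[of ?A] lookup_add sum.distrib)
qed

lemma div_degree_uminus [simp]: "div_degree (- E) = - div_degree E"
  by (simp add: div_degree_def sum_negf)

lemma div_degree_diff [simp]: "div_degree (E - E') = div_degree E - div_degree E'"
  using div_degree_add[of E "- E'"] by simp

lemma div_degree_0 [simp]: "div_degree 0 = 0"
  by (simp add: div_degree_def)

lemma div_degree_frag_of [simp]: "div_degree (frag_of P) = 1"
  by (simp add: div_degree_def)

lemma div_degree_frag_cmul [simp]: "div_degree (frag_cmul k E) = k * div_degree E"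
proof -
  have "Poly_Mapping.keys (frag_cmul k E) \<subseteq> Poly_Mapping.keys E" by (rule keys_cmul)
  then show ?thesis
    by (simp add: div_degree_eq_sum[of "Poly_Mapping.keys E"] sum_distrib_left)
qed

lemma div_degree_sum [simp]: "div_degree (\<Sum>x\<in>A. f x) = (\<Sum>x\<in>A. div_degree (f x))"
  by (induction A rule: infinite_finite_induct) auto

section \<open>Effective divisors as multisets of points\<close>

lemma mu_count: "count (mu E) P = nat (Poly_Mapping.lookup E P)"
proof -
  have "count (mu E) P = (\<Sum>Q\<in>Poly_Mapping.keys E. if Q = P then nat (Poly_Mapping.lookup E Q) else 0)"
    unfolding mu_def count_sum by (intro sum.cong) auto
  then show ?thesis by (simp add: sum.delta in_keys_iff)
qed

lemma set_mu:
  assumes "\<And>P. 0 \<le> Poly_Mapping.lookup E P"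
  shows "set_mset (mu E) = Poly_Mapping.keys E"
proof (intro Set.set_eqI)
  fix P
  have "P \<in># mu E \<longleftrightarrow> nat (Poly_Mapping.lookup E P) \<noteq> 0"
    by (simp flip: mu_count count_greater_zero_iff)
  then show "P \<in># mu E \<longleftrightarrow> P \<in> Poly_Mapping.keys E"
    using assms[of P] by (auto simp: in_keys_iff)
qed

lemma mu_in_Symg: "E \<in> eff_divs g c \<Longrightarrow> mu E \<in> Symg g c"
proof -
  assume E: "E \<in> eff_divs g c"
  then have nn: "\<And>P. 0 \<le> Poly_Mapping.lookup E P" and "Poly_Mapping.keys E \<subseteq> gam g c"
    and deg: "div_degree E = int g"
    by (auto simp: eff_divs_def Div_def)
  moreover have "size (mu E) = g"
  proof -
    have "int (size (mu E)) = (\<Sum>P\<in>Poly_Mapping.keys E. Poly_Mapping.lookup E P)"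
      unfolding mu_def using nn by (simp add: size_multiset_sum)
    then show ?thesis using deg by (simp add: div_degree_def)
  qed
  ultimately show ?thesis by (simp add: Symg_def set_mu)
qed

lemma inj_on_mu: "inj_on mu (eff_divs g c)"
proof (rule inj_onI)
  fix E E' assume E: "E \<in> eff_divs g c" "E' \<in> eff_divs g c" "mu E = mu E'"
  show "E = E'"
  proof (rule poly_mapping_eqI)
    fix P
    have "nat (Poly_Mapping.lookup E P) = nat (Poly_Mapping.lookup E' P)"
      using E(3) by (simp flip: mu_count)
    moreover have "0 \<le> Poly_Mapping.lookup E P" "0 \<le> Poly_Mapping.lookup E' P"
      using E by (auto simp: eff_divs_def)
    ultimately show "Poly_Mapping.lookup E P = Poly_Mapping.lookup E' P" by simp
  qed
qed

lemma Phi_tilde_mu: "E \<in> eff_divs g c \<Longrightarrow> Phi_tilde g c (mu E) = Phi g c E"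
  by (simp add: Phi_tilde_def inv_into_f_f[OF inj_on_mu])

section \<open>Divisors of degree zero modulo principal divisors\<close>

lemma comm_group_Div0: "comm_group (Div0 g c)"
proof -
  interpret D: comm_group "Div g c"
    unfolding Div_def by (rule abelian_free_Abelian_group)
  have "subgroup {E \<in> carrier (Div g c). div_degree E = 0} (Div g c)"
  proof (rule D.subgroupI)
    show "{E \<in> carrier (Div g c). div_degree E = 0} \<noteq> {}"
      by (auto simp: Div_def intro!: exI[of _ 0])
  qed (auto simp: Div_def subset_iff dest: subsetD[OF keys_add])
  from D.subgroup_imp_group[OF this] show ?thesis
    unfolding Div0_def by (rule group.group_comm_groupI) (auto simp: D.m_comm)
qed

lemma carrier_Div0: "E \<in> carrier (Div0 g c) \<longleftrightarrow> Poly_Mapping.keys E \<subseteq> gam g c \<and> div_degree E = 0"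
  by (simp add: Div0_def Div_def)

lemma mult_Div0 [simp]: "E \<otimes>\<^bsub>Div0 g c\<^esub> E' = E + E'"
  by (simp add: Div0_def Div_def)

lemma one_Div0 [simp]: "\<one>\<^bsub>Div0 g c\<^esub> = 0"
  by (simp add: Div0_def Div_def)

lemma inv_Div0: "E \<in> carrier (Div0 g c) \<Longrightarrow> inv\<^bsub>Div0 g c\<^esub> E = - E"
  by (rule group.inv_equality[OF comm_group.axioms(2)[OF comm_group_Div0]]) (auto simp: carrier_Div0)

lemma normal_Princ:
  assumes ns: "nonsingular_curve g c"
  shows "Princ g c \<lhd> Div0 g c"
proof -
  interpret D: comm_group "Div0 g c" by (rule comm_group_Div0)
  have "subgroup (Princ g c) (Div0 g c)"
  proof (rule D.subgroupI)
    show "Princ g c \<subseteq> carrier (Div0 g c)" by (auto simp: Princ_def)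
    have 1: "nonzero_on_curve g c 1"
    proof -
      have "\<exists>v. v ^ 2 = poly (curve_poly g c) 0" using power2_csqrt by blast
      then show ?thesis by (auto simp: nonzero_on_curve_def gam_def)
    qed
    have "ord_at g c P (\<lambda>u v. poly_uv 1 u v / poly_uv 1 u v) = 0" if "P \<in> gam g c" for P
      using ord_at_divide(2)[OF ns that 1 1 1 1] by simp
    then have "0 \<in> Princ g c"
      using 1 unfolding Princ_def principal_div_def carrier_Div0 by force
    then show "Princ g c \<noteq> {}" by auto
  next
    fix E assume E: "E \<in> Princ g c"
    then obtain N M where NM: "nonzero_on_curve g c N" "nonzero_on_curve g c M"
      "\<forall>P \<in> gam g c. Poly_Mapping.lookup E P = ord_at g c P (\<lambda>u v. poly_uv N u v / poly_uv M u v)"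
      unfolding Princ_def principal_div_def by blast
    have "principal_div g c (- E)"
      unfolding principal_div_def
    proof (rule exI[of _ M], rule exI[of _ N], intro conjI ballI)
      fix P assume "P \<in> gam g c"
      then show "Poly_Mapping.lookup (- E) P = ord_at g c P (\<lambda>u v. poly_uv M u v / poly_uv N u v)"
        using NM ord_at_divide(2)[OF ns _ NM(1,2) NM(1,2)] by simp
    qed (fact NM)+
    then show "inv\<^bsub>Div0 g c\<^esub> E \<in> Princ g c"
      using E by (auto simp: Princ_def inv_Div0 carrier_Div0)
  next
    fix E E' assume E: "E \<in> Princ g c" "E' \<in> Princ g c"
    then obtain N M where NM: "nonzero_on_curve g c N" "nonzero_on_curve g c M"
      "\<forall>P \<in> gam g c. Poly_Mapping.lookup E P = ord_at g c P (\<lambda>u v. poly_uv N u v / poly_uv M u v)"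
      unfolding Princ_def principal_div_def by blast
    obtain N' M' where NM': "nonzero_on_curve g c N'" "nonzero_on_curve g c M'"
      "\<forall>P \<in> gam g c. Poly_Mapping.lookup E' P = ord_at g c P (\<lambda>u v. poly_uv N' u v / poly_uv M' u v)"
      using E unfolding Princ_def principal_div_def by blast
    have "principal_div g c (E + E')"
      unfolding principal_div_def
    proof (rule exI[of _ "N * N'"], rule exI[of _ "M * M'"], intro conjI ballI)
      fix P assume "P \<in> gam g c"
      then show "Poly_Mapping.lookup (E + E') P
          = ord_at g c P (\<lambda>u v. poly_uv (N * N') u v / poly_uv (M * M') u v)"
        using NM NM' ord_at_divide(1)[OF ns _ NM(1,2) NM'(1,2)] by (simp add: lookup_add del: poly_uv_mult)
    qed (use NM NM' nonzero_on_curve_mult[OF ns] in auto)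
    then show "E \<otimes>\<^bsub>Div0 g c\<^esub> E' \<in> Princ g c"
      using E D.m_closed[of E E'] by (auto simp: Princ_def)
  qed
  then show ?thesis by (rule D.subgroup_imp_normal)
qed

lemma D_star_in_Div: "Poly_Mapping.keys (D_star g) \<subseteq> gam g c" "div_degree (D_star g) = int g"
proof -
  have "Poly_Mapping.keys (frag_cmul k (frag_of PInf + frag_of PInf')) \<subseteq> gam g c" for k
    by (rule order.trans[OF keys_cmul], rule order.trans[OF keys_add]) (auto simp: gam_def)
  then show "Poly_Mapping.keys (D_star g) \<subseteq> gam g c"
    unfolding D_star_def by (auto dest!: subsetD[OF keys_add] simp: gam_def)
  show "div_degree (D_star g) = int g"
    by (auto simp: D_star_def elim!: evenE oddE)
qed

lemma eff_div_minus_D_star: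
  assumes "E \<in> eff_divs g c"
  shows "E - D_star g \<in> carrier (Div0 g c)"
proof -
  have "Poly_Mapping.keys (E - D_star g) \<subseteq> gam g c"
    using keys_diff[of E "D_star g"] assms D_star_in_Div(1)[of g c] by (auto simp: eff_divs_def Div_def)
  then show ?thesis using assms D_star_in_Div(2) by (simp add: carrier_Div0 eff_divs_def)
qed

text \<open>Each of the three classes subtracts \<open>D_star g\<close> once, so exactly one copy
  survives in \<open>(E1 - D_star g) + (E2 - D_star g) - (E3 - D_star g)\<close>. Its degree
  vanishes automatically.\<close>

lemma sym_sumI:
  assumes ns: "nonsingular_curve g c"
    and E: "E1 \<in> eff_divs g c" "E2 \<in> eff_divs g c" "E3 \<in> eff_divs g c"
    and pr: "principal_div g c (E1 + E2 - D_star g - E3)"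
  shows "mu E3 \<in> sym_sum g c (mu E1) (mu E2)"
proof -
  interpret D: comm_group "Div0 g c" by (rule comm_group_Div0)
  interpret N: normal "Princ g c" "Div0 g c" by (rule normal_Princ[OF ns])
  note d = E[THEN eff_div_minus_D_star]
  let ?E = "E1 + E2 - D_star g - E3"
  have "?E = (E1 - D_star g) + (E2 - D_star g) - (E3 - D_star g)" by simp
  also have "\<dots> \<in> carrier (Div0 g c)"
    using D.m_closed[OF D.m_closed[OF d(1,2)] D.inv_closed[OF d(3)]] inv_Div0[OF d(3)] by simp
  finally have "?E \<in> Princ g c" using pr unfolding Princ_def by blast
  from D.rcosI[OF this N.subset d(3)]
  have "(E1 - D_star g) + (E2 - D_star g) \<in> Princ g c #>\<^bsub>Div0 g c\<^esub> (E3 - D_star g)"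
    by (simp add: algebra_simps)
  from D.repr_independence[OF this d(3) N.subgroup_axioms]
  have "Phi g c E3 = Princ g c #>\<^bsub>Div0 g c\<^esub> ((E1 - D_star g) \<otimes>\<^bsub>Div0 g c\<^esub> (E2 - D_star g))"
    unfolding Phi_def by simp
  also have "\<dots> = Phi g c E1 \<otimes>\<^bsub>Pic0 g c\<^esub> Phi g c E2"
    using N.rcos_sum[OF d(1,2)] unfolding Phi_def Pic0_def FactGroup_def by simp
  finally have "Phi g c E3 = Phi g c E1 \<otimes>\<^bsub>Pic0 g c\<^esub> Phi g c E2" .
  then show ?thesis
    using E mu_in_Symg by (simp add: sym_sum_def Phi_tilde_mu)
qed

section \<open>Eigenvector divisors\<close>

lemma lax_plus_eq:
  assumes "g \<ge> 2"
  shows "x \<cdot>\<^sub>m 1\<^sub>m (g + 1) + lax g (I, V) y =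
    Matrix.mat (g + 1) (g + 1) (\<lambda>(r, s). tridiag (\<lambda>i. x + I (i + 1) + V i) (\<lambda>i. I i * V i) 1 (r, s)
       + (if r = 0 \<and> s = g then (-1) ^ g * (I 1 * V 1) / y else 0)
       + (if r = g \<and> s = 0 then (-1) ^ g * y else 0))"
  by (rule eq_matI) (use assms in \<open>auto simp: lax_def tridiag_def ac_simps\<close>)

lemma block_plus_eq:
  "x \<cdot>\<^sub>m 1\<^sub>m g + lax_block g (I, V) y =
    Matrix.mat g g (tridiag (\<lambda>i. x + I (i + 1) + V i) (\<lambda>i. I i * V i) 1)"
  by (rule eq_matI) (auto simp: lax_block_def tridiag_def ac_simps)

lemma total_prod_shift:
  "total_prod g a = a 1 * (\<Prod>j = 1..g. a (1 + int j))"
proof -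
  have "total_prod g a = (\<Prod>j = 1..g + 1. a (int j))"
    unfolding total_prod_def
    by (rule prod.reindex_bij_witness[of _ int nat]) auto
  also have "\<dots> = a 1 * (\<Prod>j = 2..g + 1. a (int j))"
    by (subst prod.atLeast_Suc_atMost) (auto simp: numeral_2_eq_2)
  also have "(\<Prod>j = 2..g + 1. a (int j)) = (\<Prod>j = 1..g. a (1 + int j))"
    by (rule prod.reindex_bij_witness[of _ Suc "\<lambda>j. j - 1"]) (auto simp: ac_simps)
  finally show ?thesis .
qed

lemma f_tilde_eq:
  assumes "g \<ge> 2" "y \<noteq> 0"
  shows "f_tilde g (I, V) x y = y ^ 2
    + y * (lax_cont I V x 1 (g + 1) - I 1 * V 1 * lax_cont I V x 2 (g - 1)) + total_prod g I * total_prod g V"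
proof -
  have sg: "(-1) ^ g * ((-1) ^ g * z) = z" for z :: complex
    by (simp add: mult.assoc[symmetric] power_mult_distrib[symmetric])
  have "f_tilde g (I, V) x y = y * (lax_cont I V x 1 (g + 1)
      - ((-1) ^ g * (I 1 * V 1) / y) * ((-1) ^ g * y) * lax_cont I V x 2 (g - 1)
      + (-1) ^ g * ((-1) ^ g * y + ((-1) ^ g * (I 1 * V 1) / y) * (\<Prod>j = 1..g. I (1 + int j) * V (1 + int j))))"
    unfolding f_tilde_def lax_plus_eq[OF assms(1)] det_cyclic_tridiag[OF assms(1)] lax_cont_def by simp
  also have "\<dots> = y ^ 2 + y * (lax_cont I V x 1 (g + 1) - I 1 * V 1 * lax_cont I V x 2 (g - 1))
      + (I 1 * V 1) * (\<Prod>j = 1..g. I (1 + int j) * V (1 + int j))"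
  proof -
    have "((-1) ^ g * (I 1 * V 1) / y) * ((-1) ^ g * y) = I 1 * V 1"
      using assms(2) sg[of "I 1 * V 1"] by (simp add: ac_simps)
    moreover have "(-1) ^ g * ((-1) ^ g * y + ((-1) ^ g * (I 1 * V 1) / y) * q) = y + I 1 * V 1 / y * q" for q
      unfolding distrib_left sg using sg[of "I 1 * V 1 / y * q"] by simp
    ultimately show ?thesis
      using assms(2) by (simp add: field_simps power2_eq_square)
  qed
  finally show ?thesis by (simp add: total_prod_shift prod.distrib ac_simps)
qed

lemma ev_minor_1_eq:
  assumes "g \<ge> 2"
  shows "ev_minor g (I, V) 1 x y = (-1) ^ g * (I 1 * V 1 * lax_cont I V x 2 (g - 1) / y - 1)"
proof -
  have 1: "replace_col (x \<cdot>\<^sub>m 1\<^sub>m g + lax_block g (I, V) y)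
        (Matrix.vec g (\<lambda>i. lax_entry g (I, V) y (i + 1) (g + 1))) (1 - 1)
     = Matrix.mat g g (\<lambda>(r, s). if s = 0 then (if r = 0 then (-1) ^ g * (I 1 * V 1) / y else if r = g - 1 then 1 else 0)
       else tridiag (\<lambda>i. x + I (i + 1) + V i) (\<lambda>i. I i * V i) 1 (r, s))"
    unfolding block_plus_eq replace_col_def
    by (rule eq_matI) (use assms in auto)
  have "(-1) ^ (g - 1) = - ((-1) ^ g :: complex)" using assms by (cases g) auto
  then show ?thesis
    unfolding ev_minor_def 1 det_replace_first_col[OF assms] lax_cont_def
    by (simp add: algebra_simps)
qed

lemma ev_minor_2_eq:
  assumes "g \<ge> 2"
  shows "ev_minor g (I, V) 2 x y =
    (-1) ^ g * (x + I 2 + V 1 - I 1 * V 1 * (I 2 * V 2) * lax_cont I V x 3 (g - 2) / y)"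
proof -
  have 1: "replace_col (x \<cdot>\<^sub>m 1\<^sub>m g + lax_block g (I, V) y)
        (Matrix.vec g (\<lambda>i. lax_entry g (I, V) y (i + 1) (g + 1))) (2 - 1)
     = Matrix.mat g g (\<lambda>(r, s). if s = 1 then (if r = 0 then (-1) ^ g * (I 1 * V 1) / y else if r = g - 1 then 1 else 0)
       else tridiag (\<lambda>i. x + I (i + 1) + V i) (\<lambda>i. I i * V i) 1 (r, s))"
    unfolding block_plus_eq replace_col_def
    by (rule eq_matI) (use assms in auto)
  show ?thesis
    unfolding ev_minor_def 1 det_replace_second_col[OF assms] lax_cont_def
    by (simp add: algebra_simps)
qed

text \<open>\<open>lax_cont\<close> over the polynomial ring, with constant coefficients and the
  indeterminate as spectral parameter. Degrees and root multiplicities are taken here, identities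
  between values at \<open>x\<close> in \<open>lax_cont\<close>.\<close>

definition lax_poly :: "(int \<Rightarrow> complex) \<Rightarrow> (int \<Rightarrow> complex) \<Rightarrow> int \<Rightarrow> nat \<Rightarrow> complex poly" where
  "lax_poly I V = lax_cont (\<lambda>i. [:I i:]) (\<lambda>i. [:V i:]) [:0, 1:]"

lemma poly_lax_poly [simp]: "poly (lax_poly I V i k) x = lax_cont I V x i k"
  unfolding lax_poly_def
  by (induction k rule: induct_nat_012) (simp_all add: lax_cont_simps algebra_simps)

lemma lax_poly_monic: "degree (lax_poly I V i k) = k \<and> coeff (lax_poly I V i k) k = 1"
proof (induction k rule: induct_nat_012)
  case (ge2 k)
  let ?D = "lax_poly I V i"
  have 1: "?D (Suc (Suc k)) = [:I (i + int k + 2) + V (i + int k + 1), 1:] * ?D (Suc k)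
      - Polynomial.smult (I (i + int k + 1) * V (i + int k + 1)) (?D k)"
    by (simp add: lax_poly_def lax_cont_simps mult.commute)
  let ?p = "[:I (i + int k + 2) + V (i + int k + 1), 1:] * ?D (Suc k)"
  let ?q = "Polynomial.smult (I (i + int k + 1) * V (i + int k + 1)) (?D k)"
  have "?D (Suc k) \<noteq> 0" using ge2 by auto
  then have p: "degree ?p = Suc (Suc k)" using ge2 by (subst degree_mult_eq) auto
  have lp: "coeff ?p (Suc (Suc k)) = 1"
    using lead_coeff_mult[of "[:I (i + int k + 2) + V (i + int k + 1), 1:]" "?D (Suc k)"] ge2
    unfolding p by simp
  have q: "degree ?q < Suc (Suc k)" using degree_smult_le[of _ "?D k"] ge2 by (simp add: le_less_trans)
  then have "degree (?p - ?q) = Suc (Suc k)"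
    unfolding diff_conv_add_uminus using p by (subst degree_add_eq_left) auto
  then show ?case unfolding 1 using lp coeff_eq_0[OF q] by simp
qed (simp_all add: lax_poly_def lax_cont_simps)

lemma lax_poly_nonzero [simp]: "lax_poly I V i k \<noteq> 0"
  using lax_poly_monic[of I V i k] by auto

lemma block_poly_eq: "block_poly g (I, V) y = lax_poly I V 1 g"
proof -
  have "[:0, 1:] \<cdot>\<^sub>m 1\<^sub>m g + map_mat (\<lambda>a. [:a:]) (lax_block g (I, V) y)
    = Matrix.mat g g (tridiag (\<lambda>i. [:0, 1:] + [:I (i + 1):] + [:V i:]) (\<lambda>i. [:I i:] * [:V i:]) 1)"
    by (rule eq_matI) (auto simp: lax_block_def tridiag_def ac_simps)
  then show ?thesis unfolding block_poly_def lax_poly_def lax_cont_def by (simp only: det_tridiag)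
qed

text \<open>\<open>continuant_Euler\<close> yields only the factors \<open>I_i V_i\<close> for
  \<open>i = 2, ..., g\<close>; multiplying by those for \<open>1\<close> and \<open>g + 1\<close>
  completes the product to \<open>c(-1)\<close>. At a root of \<open>D_{1..g}\<close> the last term
  drops out.\<close>

lemma lax_cont_Euler:
  assumes "g \<ge> 2"
  shows "I 1 * V 1 * lax_cont I V x 1 (g - 1) * lax_cont I V x 2 (g - 1) * (I (int g + 1) * V (int g + 1))
     = total_prod g I * total_prod g V + I 1 * V 1 * (I (int g + 1) * V (int g + 1)) * lax_cont I V x 1 g * lax_cont I V x 2 (g - 2)"
proof -
  obtain k where k: "g = Suc (Suc k)" using assms by (metis add_2_eq_Suc le_Suc_ex)
  have "lax_cont I V x 1 (Suc k) * lax_cont I V x 2 (Suc k) - lax_cont I V x 1 (Suc (Suc k)) * lax_cont I V x 2 k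
      = (\<Prod>j = 1..Suc k. I (1 + int j) * V (1 + int j))"
    using continuant_Euler[of "\<lambda>i. x + I (i + 1) + V i" "\<lambda>i. I i * V i" 1 k] unfolding lax_cont_def
    by (simp only: one_add_one)
  moreover have "total_prod g I * total_prod g V = I 1 * V 1 * (\<Prod>j = 1..g. I (1 + int j) * V (1 + int j))"
    by (simp add: total_prod_shift prod.distrib ac_simps)
  moreover have "(\<Prod>j = 1..g. I (1 + int j) * V (1 + int j))
      = (\<Prod>j = 1..Suc k. I (1 + int j) * V (1 + int j)) * (I (int g + 1) * V (int g + 1))"
    unfolding k by (simp add: ac_simps)
  ultimately show ?thesis unfolding k by (simp add: algebra_simps)
qed

text \<open>The first minor fixes \<open>y\<close>; with this \<open>y\<close>, the expansion of
  \<open>D_{1..g}\<close> at its left end turns the second minor into a nonzero multiple of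
  \<open>D_{1..g}\<close>. Conversely, \<open>lax_cont_Euler\<close> guarantees
  \<open>y \<noteq> 0\<close> at every root.\<close>

lemma ev_points_eq:
  assumes "g \<ge> 2" "total_prod g I \<noteq> 0" "total_prod g V \<noteq> 0"
  shows "ev_points g (I, V) = (\<lambda>x. (x, I 1 * V 1 * lax_cont I V x 2 (g - 1))) ` {x. lax_cont I V x 1 g = 0}"
proof -
  obtain k where k: "g = Suc (Suc k)" using assms by (metis add_2_eq_Suc le_Suc_ex)
  have rec: "lax_cont I V x 1 g = (x + I 2 + V 1) * lax_cont I V x 2 (g - 1) - I 2 * V 2 * lax_cont I V x 3 (g - 2)" for x
    using continuant_left[of "\<lambda>i. x + I (i + 1) + V i" "\<lambda>i. I i * V i" 1 k] unfolding k lax_cont_def by simp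
  have IV: "I 1 * V 1 \<noteq> 0" using assms by (auto simp: total_prod_shift)
  have "(y \<noteq> 0 \<and> ev_minor g (I, V) 1 x y = 0 \<and> ev_minor g (I, V) 2 x y = 0) \<longleftrightarrow>
     (lax_cont I V x 1 g = 0 \<and> y = I 1 * V 1 * lax_cont I V x 2 (g - 1))" (is "?l \<longleftrightarrow> ?r") for x y
  proof
    assume l: ?l
    then have y: "y = I 1 * V 1 * lax_cont I V x 2 (g - 1)"
      unfolding ev_minor_1_eq[OF assms(1)] by (auto simp: field_simps)
    have "x + I 2 + V 1 - I 1 * V 1 * (I 2 * V 2) * lax_cont I V x 3 (g - 2) / y = 0"
      using l unfolding ev_minor_2_eq[OF assms(1)] by auto
    then have "(x + I 2 + V 1) * y = I 1 * V 1 * (I 2 * V 2) * lax_cont I V x 3 (g - 2)"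
      using l by (simp add: field_simps)
    then have "I 1 * V 1 * lax_cont I V x 1 g = 0"
      unfolding rec y by (simp add: algebra_simps)
    then show ?r using IV y by simp
  next
    assume r: ?r
    have "I 1 * V 1 * lax_cont I V x 1 (g - 1) * lax_cont I V x 2 (g - 1) * (I (int g + 1) * V (int g + 1))
        = total_prod g I * total_prod g V"
      using lax_cont_Euler[OF assms(1), of I V x] r by simp
    then have y: "y \<noteq> 0" using r assms by auto
    have "(x + I 2 + V 1) * y = I 1 * V 1 * (I 2 * V 2) * lax_cont I V x 3 (g - 2)"
      using r unfolding rec by (simp add: algebra_simps)
    then have "x + I 2 + V 1 - I 1 * V 1 * (I 2 * V 2) * lax_cont I V x 3 (g - 2) / y = 0"
      using y by (simp add: field_simps)
    moreover have "I 1 * V 1 * lax_cont I V x 2 (g - 1) / y = 1" using r y by simp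
    ultimately show ?l
      using y unfolding ev_minor_1_eq[OF assms(1)] ev_minor_2_eq[OF assms(1)] by simp
  qed
  then show ?thesis unfolding ev_points_def by auto
qed

text \<open>The divisor of a Mumford pair: over each root of \<open>u\<close> one point, of height
  \<open>w\<close>, with the multiplicity of the root. Only the values of \<open>w\<close> at the
  roots enter.\<close>

definition mumford_div :: "complex poly \<Rightarrow> (complex \<Rightarrow> complex) \<Rightarrow> (point \<Rightarrow>\<^sub>0 int)" where
  "mumford_div u w = (\<Sum>x | poly u x = 0. frag_cmul (int (Polynomial.order x u)) (frag_of (Aff x (w x))))"

lemma lookup_mumford_div:
  assumes "u \<noteq> 0"
  shows "Poly_Mapping.lookup (mumford_div u w) P =
    (case P of Aff a b \<Rightarrow> if b = w a then int (Polynomial.order a u) else 0 | _ \<Rightarrow> 0)"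
proof -
  have "Poly_Mapping.lookup (mumford_div u w) P
      = (\<Sum>x | poly u x = 0. if P = Aff x (w x) then int (Polynomial.order x u) else 0)"
    unfolding mumford_div_def lookup_sum by (intro sum.cong) auto
  also have "\<dots> = (case P of Aff a b \<Rightarrow> if b = w a then int (Polynomial.order a u) else 0 | _ \<Rightarrow> 0)"
  proof (cases P)
    case (Aff a b)
    have "(\<Sum>x | poly u x = 0. if P = Aff x (w x) then int (Polynomial.order x u) else 0)
        = (\<Sum>x | poly u x = 0. if a = x then (if b = w a then int (Polynomial.order a u) else 0) else 0)"
      by (intro sum.cong) (auto simp: Aff)
    also have "\<dots> = (if b = w a then int (Polynomial.order a u) else 0)"
      using assms poly_roots_finite[OF assms] by (auto simp: sum.delta' order_root)
    finally show ?thesis by (simp add: Aff)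
  qed simp_all
  finally show ?thesis .
qed

lemma sum_order_eq_degree:
  fixes u :: "complex poly"
  assumes "u \<noteq> 0"
  shows "(\<Sum>x | poly u x = 0. Polynomial.order x u) = degree u"
proof -
  have "degree u = degree (\<Prod>x | poly u x = 0. [:-x, 1:] ^ Polynomial.order x u)"
    using complex_poly_decompose[of u] assms by (metis degree_smult_eq leading_coeff_0_iff)
  also have "\<dots> = (\<Sum>x | poly u x = 0. degree ([:-x, 1:] ^ Polynomial.order x u))"
    by (rule degree_prod_eq_sum_degree) auto
  also have "\<dots> = (\<Sum>x | poly u x = 0. Polynomial.order x u)"
    by (intro sum.cong) (auto simp: degree_power_eq)
  finally show ?thesis by simp
qed

section \<open>The time evolution\<close>

text \<open>The product runs downwards from \<open>i - 1\<close>, as in \<open>toda_denom\<close>.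
  Advancing \<open>i\<close> by one replaces one factor by its periodic copy.\<close>

lemma total_prod_eq_shifted:
  assumes "cyclic g a"
  shows "(\<Prod>j = 1..g + 1. a (i - int j)) = total_prod g a"
proof -
  define f where "f i = (\<Prod>j = 1..g + 1. a (i - int j))" for i
  have step: "f (i + 1) = f i" for i
  proof -
    have "f (i + 1) = a i * (\<Prod>j = 2..g + 1. a (i + 1 - int j))"
      unfolding f_def by (subst prod.atLeast_Suc_atMost) (auto simp: numeral_2_eq_2)
    also have "(\<Prod>j = 2..g + 1. a (i + 1 - int j)) = (\<Prod>j = 1..g. a (i - int j))"
      by (rule prod.reindex_bij_witness[of _ Suc "\<lambda>j. j - 1"]) (auto simp: algebra_simps)
    also have "a i = a (i - int (g + 1))"
      using assms[unfolded cyclic_def, rule_format, of "i - int (g + 1)"] by simp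
    finally show ?thesis unfolding f_def by (simp add: mult.commute)
  qed
  have const: "f i = f 0" for i
  proof (induction i rule: int_induct[where k = 0])
    case (step1 i)
    then show ?case using step[of i] by simp
  next
    case (step2 i)
    then show ?case using step[of "i - 1"] by simp
  qed simp
  have "total_prod g a = f (int g + 2)"
    unfolding f_def total_prod_def
    by (rule prod.reindex_bij_witness[of _ "\<lambda>j. int g + 2 - int j" "\<lambda>j. nat (int g + 2 - j)"]) auto
  then show ?thesis using const[of i] const[of "int g + 2"] unfolding f_def by simp
qed

lemma total_prod_Suc:
  assumes "cyclic g a"
  shows "total_prod g (\<lambda>i. a (i + 1)) = total_prod g a"
proof -
  have "cyclic g (\<lambda>i. a (i + 1))"
    using assms unfolding cyclic_def by (metis add.assoc add.commute)
  from total_prod_eq_shifted[OF this, of 0] show ?thesis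
    using total_prod_eq_shifted[OF assms, of 1] by (simp add: algebra_simps)
qed

lemma total_prod_mult: "total_prod g (\<lambda>i. a i * b i) = total_prod g a * total_prod g b"
  by (simp add: total_prod_def prod.distrib)

lemma total_prod_divide: "total_prod g (\<lambda>i. a i / b i) = total_prod g a / total_prod g b"
  by (simp add: total_prod_def prod_dividef)

lemma cyclic_divide: "cyclic g a \<Longrightarrow> cyclic g b \<Longrightarrow> cyclic g (\<lambda>i. a i / b i)"
  by (simp add: cyclic_def)

lemma cyclic_toda_denom:
  assumes "cyclic g I" "cyclic g V"
  shows "cyclic g (toda_denom g I V)"
proof -
  have "V (i + int (g + 1) - int j) = V (i - int j)" "I (i + int (g + 1) - int j) = I (i - int j)" for i j
    using assms[unfolded cyclic_def, THEN spec, of "i - int j"] by (simp_all add: algebra_simps)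
  then show ?thesis unfolding cyclic_def toda_denom_def by simp
qed

text \<open>Multiplying the sum by \<open>V i / I i\<close> lengthens each product by one factor and
  advances its starting index. The longest one wraps around the whole period and becomes the
  constant \<open>total_prod g V / total_prod g I\<close>.\<close>

lemma toda_denom_Suc:
  assumes "cyclic g I" "cyclic g V" "g \<ge> 1"
  shows "toda_denom g I V (i + 1) = 1 - total_prod g V / total_prod g I + V i / I i * toda_denom g I V i"
proof -
  define r where "r i = V i / I i" for i
  define p where "p i k = (\<Prod>j = 1..k. r (i - int j))" for i k
  have d: "toda_denom g I V i = 1 + (\<Sum>k = 1..g. p i k)" for i
    by (simp add: toda_denom_def p_def r_def)
  have p: "p (i + 1) (Suc k) = r i * p i k" for k
  proof -
    have "p (i + 1) (Suc k) = r i * (\<Prod>j = 2..Suc k. r (i + 1 - int j))"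
      unfolding p_def by (subst prod.atLeast_Suc_atMost) (auto simp: numeral_2_eq_2)
    also have "(\<Prod>j = 2..Suc k. r (i + 1 - int j)) = p i k"
      unfolding p_def
      by (rule prod.reindex_bij_witness[of _ Suc "\<lambda>j. j - 1"]) (auto simp: algebra_simps)
    finally show ?thesis .
  qed
  have full: "r i * p i g = total_prod g V / total_prod g I"
    using total_prod_eq_shifted[OF cyclic_divide[OF assms(2,1)], of "i + 1"] p[of g]
    by (simp add: p_def r_def total_prod_divide)
  have "(\<Sum>k = 1..g. p (i + 1) k) = (\<Sum>k = 0..<g. p (i + 1) (Suc k))"
    by (rule sum.reindex_bij_witness[of _ Suc "\<lambda>j. j - 1"]) auto
  also have "\<dots> = r i * (\<Sum>k = 0..<g. p i k)"
    by (simp only: p sum_distrib_left)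
  also have "(\<Sum>k = 0..<g. p i k) = 1 + (\<Sum>k = 1..g. p i k) - p i g"
  proof -
    have "(\<Sum>k = 0..<g. p i k) + p i g = (\<Sum>k = 0..g. p i k)"
      by (simp flip: atLeastLessThanSuc_atLeastAtMost)
    also have "\<dots> = p i 0 + (\<Sum>k = 1..g. p i k)"
      by (subst sum.atLeast_Suc_atMost) auto
    finally show ?thesis by (simp add: p_def eq_diff_eq)
  qed
  finally show ?thesis
    unfolding d using full by (simp add: r_def algebra_simps)
qed

lemma chi_relations:
  assumes cyc: "cyclic g I" "cyclic g V" and g: "g \<ge> 1" and "chi_defined g (I, V)"
  shows "I_bar g I V (i + 1) + V_bar g I V i = I (i + 1) + V (i + 1)"
    and "I_bar g I V i * V_bar g I V i = I (i + 1) * V i"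
    and "cyclic g (I_bar g I V)" "cyclic g (V_bar g I V)"
    and "total_prod g (I_bar g I V) = total_prod g I"
    and "total_prod g (V_bar g I V) = total_prod g V"
proof -
  let ?d = "toda_denom g I V" and ?q = "total_prod g V / total_prod g I"
  have nz: "I i \<noteq> 0" "?d i \<noteq> 0" "I_bar g I V i \<noteq> 0" for i
    using assms(4) by auto
  \<comment> \<open>The recursion for the denominators makes the new variables ratios of
    neighbouring denominators. Products over a period then telescope, and periodicity is
    inherited.\<close>
  have Ib: "I_bar g I V i = I i * (?d (i + 1) / ?d i)" for i
    unfolding I_bar_def toda_denom_Suc[OF cyc g] using nz[of i] by (simp add: field_simps)
  have Vb: "V_bar g I V i = I (i + 1) * V i * ?d i / (I i * ?d (i + 1))" for i
    unfolding V_bar_def Ib by simp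
  show "I_bar g I V i * V_bar g I V i = I (i + 1) * V i"
    unfolding V_bar_def using nz[of i] by simp
  show "I_bar g I V (i + 1) + V_bar g I V i = I (i + 1) + V (i + 1)"
  proof -
    have 1: "?d (i + 1 + 1) = 1 - ?q + V (i + 1) / I (i + 1) * ?d (i + 1)"
      by (rule toda_denom_Suc[OF cyc g])
    have 2: "V i / I i * ?d i = ?d (i + 1) - (1 - ?q)"
      unfolding toda_denom_Suc[OF cyc g, of i] by simp
    have "I_bar g I V (i + 1) + V_bar g I V i = I (i + 1) / ?d (i + 1) * (?d (i + 1 + 1) + V i / I i * ?d i)"
      unfolding Ib Vb using nz[of i] nz[of "i + 1"] by (simp add: field_simps)
    also have "\<dots> = I (i + 1) / ?d (i + 1) * (V (i + 1) / I (i + 1) * ?d (i + 1) + ?d (i + 1))"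
      unfolding 1 2 by simp
    also have "\<dots> = I (i + 1) + V (i + 1)"
      using nz[of "i + 1"] by (simp add: field_simps)
    finally show ?thesis .
  qed
  note dc = cyclic_toda_denom[OF cyc]
  have c: "I (i + int (g + 1)) = I i" "V (i + int (g + 1)) = V i" "?d (i + int (g + 1)) = ?d i" for i
    using cyc dc by (simp_all only: cyclic_def)
  have c1: "I (i + int (g + 1) + 1) = I (i + 1)" "?d (i + int (g + 1) + 1) = ?d (i + 1)" for i
    using c[of "i + 1"] by (simp_all add: algebra_simps)
  show "cyclic g (I_bar g I V)" "cyclic g (V_bar g I V)"
    unfolding cyclic_def Ib Vb c c1 by simp_all
  have dnz: "total_prod g ?d \<noteq> 0" and Inz: "total_prod g I \<noteq> 0"
    using nz by (auto simp: total_prod_def)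
  show *: "total_prod g (I_bar g I V) = total_prod g I"
    unfolding Ib using dnz by (simp add: total_prod_mult total_prod_divide total_prod_Suc[OF dc])
  have "total_prod g (V_bar g I V) = total_prod g (\<lambda>i. I (i + 1)) * total_prod g V / total_prod g (I_bar g I V)"
    by (simp add: V_bar_def[abs_def] total_prod_divide total_prod_mult)
  then show "total_prod g (V_bar g I V) = total_prod g V"
    using Inz by (simp add: * total_prod_Suc[OF cyc(1)])
qed

section \<open>The isolevel sets\<close>

lemma cyclicD: "cyclic g a \<Longrightarrow> a (int g + 2) = a 1"
  unfolding cyclic_def by (drule spec[of _ 1]) (simp add: ac_simps)

lemma cut_cont_at_0: "cut_cont I V 0 k = (\<Prod>j = 1..k. I (1 + int j))"
proof (induction k)
  case (Suc k)
  then show ?case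
    using conjunct1[OF cut_cont_shift_cont[of I V 0 k]] by (simp add: ac_simps)
qed (simp add: cut_cont_simps)

text \<open>The value \<open>P(x)\<close> computed from the coordinates: the coefficient of
  \<open>y\<close> in \<open>f_tilde\<close>.\<close>

definition spec_val :: "nat \<Rightarrow> (int \<Rightarrow> complex) \<Rightarrow> (int \<Rightarrow> complex) \<Rightarrow> complex \<Rightarrow> complex" where
  "spec_val g I V x = lax_cont I V x 1 (g + 1) - I 1 * V 1 * lax_cont I V x 2 (g - 1)"

text \<open>The left side is \<open>s (s - P) + c(-1)\<close>. By periodicity
  \<open>I (g + 2) = I 1\<close>, so \<open>s - P\<close> equals
  \<open>I_1 D_{1..g} - D_{1..g+1}\<close>, and the claim is \<open>I 1\<close> times
  \<open>cut_lax_shift_cont\<close> for \<open>k = g\<close>.\<close>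

lemma norm_identity:
  assumes "cyclic g I" "g \<ge> 1"
  shows "(I 1 * cut_cont I V x g) * (I 1 * cut_cont I V x g - spec_val g I V x) + total_prod g I * total_prod g V
    = - I 1 * x * lax_cont I V x 1 g * shift_cont I V x 1 g"
proof -
  have 1: "cut_cont I V x g * (lax_cont I V x 1 (Suc g) - I 1 * lax_cont I V x 1 g) - x * lax_cont I V x 1 g * shift_cont I V x 1 g
      = total_prod g V * (\<Prod>j = 1..g. I (1 + int j))"
  proof -
    have "total_prod g V = (\<Prod>j = 1..Suc g. V (int j))"
      unfolding total_prod_def by (rule prod.reindex_bij_witness[of _ int nat]) auto
    then show ?thesis
      using cut_lax_shift_cont[of I V x g] cyclicD[OF assms(1)] by (simp add: add.commute del: prod.cl_ivl_Suc)
  qed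
  have 2: "I 1 * cut_cont I V x g - spec_val g I V x = - (lax_cont I V x 1 (Suc g) - I 1 * lax_cont I V x 1 g)"
    using assms(2) by (simp add: spec_val_def cut_cont_def algebra_simps)
  have "total_prod g I * total_prod g V = I 1 * (total_prod g V * (\<Prod>j = 1..g. I (1 + int j)))"
    by (simp add: total_prod_shift[of g I] ac_simps)
  then show ?thesis
    unfolding 1[symmetric] 2 by (simp add: algebra_simps)
qed

text \<open>This locates the zeros of \<open>y + s\<close> over the roots of \<open>u'\<close>:
  there \<open>s\<close> is the new minor of length \<open>g + 1\<close>, that is
  \<open>P + I'_1 V'_1 D'_{2..g}\<close>. Hence \<open>y + s = 0\<close> means
  \<open>v = - (P + 2 I'_1 V'_1 D'_{2..g})\<close>, the conjugate of the new point.\<close>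

lemma cut_cont_at_root:
  assumes "cyclic g I" "g \<ge> 1" "shift_cont I V x 1 g = 0"
  shows "I 1 * cut_cont I V x g = shift_cont I V x 1 (g + 1)"
proof -
  obtain k where k: "g = Suc k" using assms(2) by (cases g) auto
  have "I (int k + 3) = I 1" using cyclicD[OF assms(1)] by (simp add: k ac_simps)
  moreover have "cut_cont I V x (Suc k) = - (V (int k + 2) * shift_cont I V x 1 k)"
    using cut_cont_shift_cont[of I V x k] assms(3) by (simp add: k eq_neg_iff_add_eq_0)
  ultimately show ?thesis
    using assms(3) by (simp add: k shift_cont_simps ac_simps)
qed

text \<open>The left side is the new \<open>P\<close>. Passing from the old long minor to the new
  one adds \<open>V 1\<close> times the difference of two minors of length \<open>g\<close>, which
  \<open>shift_cont_lax_cont\<close> converts into the two corner terms.\<close>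

lemma spec_val_conserved:
  assumes "cyclic g I" "cyclic g V" "g \<ge> 1"
  shows "shift_cont I V x 1 (g + 1) - I 2 * V 1 * shift_cont I V x 2 (g - 1) = spec_val g I V x"
proof -
  obtain k where k: "g = Suc k" using assms(3) by (cases g) auto
  have 1: "shift_cont I V x 1 (Suc g) = cut_cont I V x (Suc g) + V 1 * shift_cont I V x 1 g"
    using cut_cont_shift_cont[of I V x g] cyclicD[OF assms(2)] by simp
  have 2: "cut_cont I V x (Suc g) = lax_cont I V x 1 (Suc g) - V 1 * lax_cont I V x 2 g" by (simp add: cut_cont_def)
  have 3: "I (int k + 3) = I 1" using cyclicD[OF assms(1)] by (simp add: k ac_simps)
  have 4: "shift_cont I V x 1 g = I 2 * shift_cont I V x 2 (g - 1) + lax_cont I V x 2 g - I 1 * lax_cont I V x 2 (g - 1)"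
    using shift_cont_lax_cont[of I V x k] unfolding 3 by (simp add: k algebra_simps)
  have "shift_cont I V x 1 (Suc g) = lax_cont I V x 1 (Suc g) + V 1 * (I 2 * shift_cont I V x 2 (g - 1)) - V 1 * (I 1 * lax_cont I V x 2 (g - 1))"
    unfolding 1 2 4 by (simp add: algebra_simps)
  then show ?thesis by (simp add: spec_val_def algebra_simps)
qed

text \<open>At \<open>x = 0\<close> the right side of \<open>norm_identity\<close> vanishes and
  \<open>s\<close> is the product of all \<open>I_i\<close>, which can be cancelled.\<close>

lemma spec_val_0:
  assumes "cyclic g I" "g \<ge> 1" "total_prod g I \<noteq> 0"
  shows "spec_val g I V 0 = total_prod g I + total_prod g V"
proof -
  have "I 1 * cut_cont I V 0 g = total_prod g I" by (simp add: cut_cont_at_0 total_prod_shift)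
  then have "total_prod g I * (total_prod g I - spec_val g I V 0) + total_prod g I * total_prod g V = 0"
    using norm_identity[OF assms(1,2), of V 0] by simp
  then have "total_prod g I * (total_prod g I + total_prod g V - spec_val g I V 0) = 0"
    by (simp add: algebra_simps)
  then show ?thesis using assms(3) by simp
qed

text \<open>It suffices to test \<open>y = 1\<close> and \<open>y = -1\<close>: the difference of
  the two equations isolates \<open>P\<close>, their sum isolates \<open>c(-1)\<close>.\<close>

lemma isolevel_iff:
  assumes "g \<ge> 2"
  shows "(I, V) \<in> isolevel g c \<longleftrightarrow> (I, V) \<in> phase_space g \<and>
    (\<forall>x. poly (spec_poly g c) x = spec_val g I V x) \<and> c (-1) = total_prod g I * total_prod g V"
proof -
  have f: "f_tilde g (I, V) x y = y ^ 2 + y * spec_val g I V x + total_prod g I * total_prod g V" if "y \<noteq> 0" for x y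
    unfolding spec_val_def by (rule f_tilde_eq[OF assms that])
  have "(\<forall>x y. y \<noteq> 0 \<longrightarrow> f_tilde g (I, V) x y = y ^ 2 + y * poly (spec_poly g c) x + c (-1)) \<longleftrightarrow>
    (\<forall>x. poly (spec_poly g c) x = spec_val g I V x) \<and> c (-1) = total_prod g I * total_prod g V"
    (is "?l \<longleftrightarrow> ?r")
  proof
    assume l: ?l
    have e: "1 + spec_val g I V x + total_prod g I * total_prod g V = 1 + poly (spec_poly g c) x + c (-1)"
      "1 - spec_val g I V x + total_prod g I * total_prod g V = 1 - poly (spec_poly g c) x + c (-1)" for x
      using l[rule_format, of 1 x] l[rule_format, of "-1" x] f[of 1 x] f[of "-1" x] by simp_all
    show ?r
    proof (intro conjI allI)
      show "poly (spec_poly g c) x = spec_val g I V x" for x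
      proof -
        have "2 * poly (spec_poly g c) x = 2 * spec_val g I V x"
        proof -
          have "(1 + spec_val g I V x + total_prod g I * total_prod g V) - (1 - spec_val g I V x + total_prod g I * total_prod g V)
            = (1 + poly (spec_poly g c) x + c (-1)) - (1 - poly (spec_poly g c) x + c (-1))"
            by (simp only: e)
          then show ?thesis by simp
        qed
        then show ?thesis by simp
      qed
      have "(1 + spec_val g I V 0 + total_prod g I * total_prod g V) + (1 - spec_val g I V 0 + total_prod g I * total_prod g V)
        = (1 + poly (spec_poly g c) 0 + c (-1)) + (1 - poly (spec_poly g c) 0 + c (-1))"
        by (simp only: e)
      then show "c (-1) = total_prod g I * total_prod g V" by simp
    qed
  next
    assume ?r
    then show ?l using f by simp
  qed
  then show ?thesis unfolding isolevel_def by auto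
qed

lemma phase_spaceD:
  assumes "(I, V) \<in> phase_space g"
  shows "cyclic g I" "cyclic g V" "total_prod g I \<noteq> 0" "total_prod g V \<noteq> 0"
  using assms by (auto simp: phase_space_def)

text \<open>The height \<open>v = y - c(-1) / y = 2 y + P\<close> of the eigenvector point, with
  \<open>y = I_1 V_1 D_{2..g}\<close>.\<close>

definition mumford_v :: "nat \<Rightarrow> (int \<Rightarrow> complex) \<Rightarrow> (int \<Rightarrow> complex) \<Rightarrow> complex \<Rightarrow> complex" where
  "mumford_v g I V x = spec_val g I V x + 2 * (I 1 * V 1 * lax_cont I V x 2 (g - 1))"

text \<open>Here \<open>y + P\<close> is the long minor \<open>D_{1..g+1}\<close>, which at a root
  of \<open>D_{1..g}\<close> collapses to a multiple of \<open>D_{1..g-1}\<close>;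
  \<open>lax_cont_Euler\<close> evaluates the product.\<close>

lemma eigenvector_point:
  assumes "g \<ge> 2" "lax_cont I V x 1 g = 0"
  defines "y \<equiv> I 1 * V 1 * lax_cont I V x 2 (g - 1)"
  shows "y * (y + spec_val g I V x) = - (total_prod g I * total_prod g V)"
proof -
  obtain k where k: "g = Suc k" using assms(1) by (cases g) auto
  have "y + spec_val g I V x = lax_cont I V x 1 (g + 1)" by (simp add: y_def spec_val_def)
  also have "\<dots> = - (I (int g + 1) * V (int g + 1) * lax_cont I V x 1 (g - 1))"
    using assms(2) by (simp add: k lax_cont_simps ac_simps)
  finally have "y * (y + spec_val g I V x) = - (I 1 * V 1 * lax_cont I V x 1 (g - 1) * lax_cont I V x 2 (g - 1) * (I (int g + 1) * V (int g + 1)))"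
    by (simp add: y_def ac_simps)
  also have "\<dots> = - (total_prod g I * total_prod g V)"
    unfolding lax_cont_Euler[OF assms(1)] using assms(2) by simp
  finally show ?thesis .
qed

lemma mumford_v_square:
  assumes "g \<ge> 2" "(I, V) \<in> isolevel g c" "lax_cont I V x 1 g = 0"
  shows "mumford_v g I V x ^ 2 = poly (curve_poly g c) x"
proof -
  have "mumford_v g I V x ^ 2 = spec_val g I V x ^ 2
      + 4 * ((I 1 * V 1 * lax_cont I V x 2 (g - 1)) * (I 1 * V 1 * lax_cont I V x 2 (g - 1) + spec_val g I V x))"
    by (simp add: mumford_v_def power2_eq_square algebra_simps)
  then show ?thesis
    using assms(2) unfolding eigenvector_point[OF assms(1,3)] isolevel_iff[OF assms(1)]
    by (simp add: curve_poly_def)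
qed

lemma phi_eq:
  assumes "g \<ge> 2" "(I, V) \<in> isolevel g c"
  shows "phi g c (I, V) = mumford_div (lax_poly I V 1 g) (mumford_v g I V)"
proof -
  have ps: "(I, V) \<in> phase_space g" and c: "c (-1) = total_prod g I * total_prod g V"
    using assms isolevel_iff by auto
  note nz = phase_spaceD(3,4)[OF ps]
  let ?y = "\<lambda>x. I 1 * V 1 * lax_cont I V x 2 (g - 1)"
  have v: "?y x - c (-1) / ?y x = mumford_v g I V x" if "lax_cont I V x 1 g = 0" for x
  proof -
    have *: "?y x * (?y x + spec_val g I V x) = - c (-1)"
      using eigenvector_point[OF assms(1) that] c by simp
    then have "?y x \<noteq> 0" using c nz by auto
    moreover have "c (-1) = ?y x * - (?y x + spec_val g I V x)"
      unfolding mult_minus_right * by simp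
    ultimately have "c (-1) / ?y x = - (?y x + spec_val g I V x)"
      by (metis nonzero_mult_div_cancel_left)
    then show ?thesis by (simp add: mumford_v_def)
  qed
  have "phi g c (I, V) = (\<Sum>Q\<in>(\<lambda>x. (x, ?y x)) ` {x. lax_cont I V x 1 g = 0}.
      frag_cmul (int (ev_mult g (I, V) Q)) (frag_of (rho c Q)))"
    by (simp only: phi_def ev_points_eq[OF assms(1) nz])
  also have "\<dots> = (\<Sum>x | lax_cont I V x 1 g = 0.
      frag_cmul (int (Polynomial.order x (lax_poly I V 1 g))) (frag_of (Aff x (?y x - c (-1) / ?y x))))"
    by (subst sum.reindex) (auto simp: inj_on_def ev_mult_def block_poly_eq rho_def)
  also have "\<dots> = mumford_div (lax_poly I V 1 g) (mumford_v g I V)"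
    unfolding mumford_div_def by (rule sum.cong) (simp_all only: mem_Collect_eq poly_lax_poly v)
  finally show ?thesis .
qed

lemma phi_in_eff_divs:
  assumes "g \<ge> 2" "(I, V) \<in> isolevel g c"
  shows "phi g c (I, V) \<in> eff_divs g c"
proof -
  let ?u = "lax_poly I V 1 g"
  have nn: "0 \<le> Poly_Mapping.lookup (phi g c (I, V)) P" for P
    unfolding phi_eq[OF assms] by (simp add: lookup_mumford_div split: point.split)
  have "Poly_Mapping.keys (phi g c (I, V)) \<subseteq> gam g c"
  proof
    fix P assume "P \<in> Poly_Mapping.keys (phi g c (I, V))"
    then have "Poly_Mapping.lookup (phi g c (I, V)) P \<noteq> 0" by (simp add: in_keys_iff)
    then obtain a where a: "P = Aff a (mumford_v g I V a)" "Polynomial.order a ?u \<noteq> 0"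
      unfolding phi_eq[OF assms] by (auto simp: lookup_mumford_div split: point.splits if_splits)
    then have "poly ?u a = 0" by (simp add: order_root del: poly_lax_poly)
    then show "P \<in> gam g c"
      using mumford_v_square[OF assms, of a] a by (simp add: gam_def)
  qed
  moreover have "div_degree (phi g c (I, V)) = int g"
    unfolding phi_eq[OF assms] mumford_div_def
    using sum_order_eq_degree[of ?u] lax_poly_monic[of I V 1 g] by (simp flip: of_nat_sum)
  ultimately show ?thesis using nn by (simp add: eff_divs_def Div_def)
qed

lemma lax_cont_chi:
  assumes "cyclic g I" "cyclic g V" "g \<ge> 1" "chi_defined g (I, V)"
  shows "lax_cont (I_bar g I V) (V_bar g I V) x = shift_cont I V x"
proof -
  have "(\<lambda>i. x + I_bar g I V (i + 1) + V_bar g I V i) = (\<lambda>i. x + I (i + 1) + V (i + 1))"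
    using chi_relations(1)[OF assms] by (simp add: add.assoc)
  then show ?thesis
    unfolding lax_cont_def shift_cont_def by (simp add: chi_relations(2)[OF assms])
qed

lemma spec_val_chi:
  assumes "cyclic g I" "cyclic g V" "g \<ge> 1" "chi_defined g (I, V)"
  shows "spec_val g (I_bar g I V) (V_bar g I V) x = spec_val g I V x"
  using spec_val_conserved[OF assms(1-3), of x]
  by (simp add: spec_val_def[of g "I_bar g I V"] lax_cont_chi[OF assms] chi_relations(2)[OF assms])

lemma chi_in_isolevel:
  assumes "g \<ge> 2" "(I, V) \<in> isolevel g c" "chi_defined g (I, V)"
  shows "(I_bar g I V, V_bar g I V) \<in> isolevel g c"
proof -
  have ps: "(I, V) \<in> phase_space g" using assms isolevel_iff by auto
  have g: "g \<ge> 1" using assms by simp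
  note cyc = phase_spaceD(1,2)[OF ps]
  note rel = chi_relations[OF cyc g assms(3)]
  show ?thesis
    using assms(2) ps unfolding isolevel_iff[OF assms(1)]
    by (simp add: spec_val_chi[OF cyc g assms(3)] rel phase_space_def)
qed

section \<open>The translation\<close>

lemma T_div_minus_D_star:
  assumes "g \<ge> 2"
  shows "T_div g A - D_star g = frag_of A - frag_of PInf'"
proof (cases "even g")
  case True
  define k where "k = g div 2 - 1"
  have k: "g = 2 * Suc k" using True assms unfolding k_def by presburger
  show ?thesis using True unfolding T_div_def D_star_def
    by (intro poly_mapping_eqI) (auto simp: k lookup_add lookup_minus)
next
  case False
  define k where "k = (g - 1) div 2 - 1"
  have k: "g = 2 * Suc k + 1" using False assms unfolding k_def by presburger
  show ?thesis using False unfolding T_div_def D_star_def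
    by (intro poly_mapping_eqI) (auto simp: k lookup_add lookup_minus)
qed

lemma T_div_in_eff_divs:
  assumes "g \<ge> 2" "A \<in> gam g c"
  shows "T_div g A \<in> eff_divs g c"
proof -
  have "Poly_Mapping.keys (frag_cmul k (frag_of PInf + frag_of PInf')) \<subseteq> gam g c"
    "Poly_Mapping.keys (frag_cmul k (frag_of PInf)) \<subseteq> gam g c" for k
    by (rule order.trans[OF keys_cmul], (rule order.trans[OF keys_add])?, auto simp: gam_def)+
  then have "Poly_Mapping.keys (T_div g A) \<subseteq> gam g c"
    using assms(2) unfolding T_div_def by (auto dest!: subsetD[OF keys_add] simp: gam_def)
  moreover have "0 \<le> Poly_Mapping.lookup (T_div g A) P" for P
    by (auto simp: T_div_def lookup_add)
  moreover have "div_degree (T_div g A) = int g"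
  proof -
    have "div_degree (T_div g A - D_star g) = 0"
      unfolding T_div_minus_D_star[OF assms(1)] by simp
    then show ?thesis using D_star_in_Div(2)[of g] by simp
  qed
  ultimately show ?thesis by (simp add: eff_divs_def Div_def)
qed

text \<open>The level fixes the sum and the product of \<open>total_prod g I\<close> and
  \<open>total_prod g V\<close>, hence the square of their difference. The inequality built into the
  phase space fixes its sign.\<close>

lemma A_point_unique:
  assumes "g \<ge> 2" "U \<in> isolevel g c" "U' \<in> isolevel g c"
  shows "A_point g U = A_point g U'"
proof -
  obtain I V I' V' where U: "U = (I, V)" "U' = (I', V')" by fastforce
  have "g \<ge> 1" using assms by simp
  have ps: "(I, V) \<in> phase_space g" "(I', V') \<in> phase_space g"
    and P: "spec_val g I V 0 = spec_val g I' V' 0"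
    and c: "total_prod g I * total_prod g V = total_prod g I' * total_prod g V'"
    using assms isolevel_iff[OF assms(1)] unfolding U by auto
  obtain a b where ab: "total_prod g V = of_real a" "total_prod g I = of_real b" "0 < a" "a < b"
    using ps(1) by (auto simp: phase_space_def)
  obtain a' b' where ab': "total_prod g V' = of_real a'" "total_prod g I' = of_real b'" "0 < a'" "a' < b'"
    using ps(2) by (auto simp: phase_space_def)
  have "complex_of_real (b + a) = of_real (b' + a')"
    using P spec_val_0[OF phase_spaceD(1)[OF ps(1)] \<open>g \<ge> 1\<close> phase_spaceD(3)[OF ps(1)]]
      spec_val_0[OF phase_spaceD(1)[OF ps(2)] \<open>g \<ge> 1\<close> phase_spaceD(3)[OF ps(2)]] ab ab' by simp
  moreover have "complex_of_real (b * a) = of_real (b' * a')" using c ab ab' by simp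
  ultimately have "b + a = b' + a'" "b * a = b' * a'" by (simp_all only: of_real_eq_iff)
  moreover have "(q - p) ^ 2 = (q + p) ^ 2 - 4 * (q * p)" for p q :: real
    by (simp add: power2_eq_square algebra_simps)
  ultimately have "(b - a) ^ 2 = (b' - a') ^ 2" by metis
  then have "b - a = b' - a'" using ab ab' by (simp add: power2_eq_iff)
  then have "a - b = a' - b'" by simp
  then have "complex_of_real a - of_real b = of_real a' - of_real b'"
    by (metis of_real_diff)
  then show ?thesis unfolding U using ab ab' by simp
qed

lemma A_point_in_gam:
  assumes "g \<ge> 2" "(I, V) \<in> isolevel g c"
  shows "A_point g (I, V) \<in> gam g c"
proof -
  have ps: "(I, V) \<in> phase_space g" and g: "g \<ge> 1"
    and P: "poly (spec_poly g c) 0 = spec_val g I V 0" "c (-1) = total_prod g I * total_prod g V"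
    using assms isolevel_iff[OF assms(1)] by auto
  have "(total_prod g V - total_prod g I) ^ 2 = poly (curve_poly g c) 0"
    unfolding curve_poly_def
    by (simp add: P spec_val_0[OF phase_spaceD(1)[OF ps] g phase_spaceD(3)[OF ps]])
      (simp add: power2_eq_square algebra_simps)
  then show ?thesis by (simp add: gam_def)
qed

lemma nonzero_on_curveI:
  assumes "p \<noteq> 0" "\<And>u v. v ^ 2 = poly (curve_poly g c) u \<Longrightarrow> poly p u \<noteq> 0 \<Longrightarrow> poly_uv N u v \<noteq> 0"
  shows "nonzero_on_curve g c N"
proof -
  obtain u where "poly p u \<noteq> 0" using assms(1) poly_all_0_iff_0 by blast
  moreover have "csqrt (poly (curve_poly g c) u) ^ 2 = poly (curve_poly g c) u" by simp
  ultimately show ?thesis using assms(2) unfolding nonzero_on_curve_def gam_def by blast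
qed

lemma lookup_frag_of_apply: "Poly_Mapping.lookup (frag_of P) Q = (if Q = P then 1 else 0)"
  by simp

lemma principal_translation:
  assumes "g \<ge> 2" "nonsingular_curve g c" "(I, V) \<in> isolevel g c" "chi_defined g (I, V)"
  shows "principal_div g c (phi g c (I, V) + (frag_of (A_point g (I, V)) - frag_of PInf') - phi g c (chi g (I, V)))"
proof -
  let ?I = "I_bar g I V" and ?V = "V_bar g I V" and ?P = "spec_poly g c"
  have g: "g \<ge> 1" using assms by simp
  have ps: "(I, V) \<in> phase_space g" and P: "\<And>x. poly ?P x = spec_val g I V x"
    and c: "c (-1) = total_prod g I * total_prod g V"
    using assms isolevel_iff[OF assms(1)] by auto
  note cyc = phase_spaceD(1,2)[OF ps] and nz = phase_spaceD(3,4)[OF ps]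
  note rel = chi_relations[OF cyc g assms(4)]
  have iso': "(?I, ?V) \<in> isolevel g c" by (rule chi_in_isolevel[OF assms(1,3,4)])
  have I1: "I 1 \<noteq> 0" using nz by (auto simp: total_prod_shift)
  define u where "u = lax_poly I V 1 g"
  define u' where "u' = lax_poly ?I ?V 1 g"
  define s where "s = Polynomial.smult (I 1) (u - Polynomial.smult (V 1) (lax_poly I V 2 (g - 1)))"
  \<comment> \<open>With this choice \<open>S(u) + v / 2\<close> is \<open>(v - P) / 2 + s\<close>.
    Since \<open>s\<close> has degree at most \<open>g\<close>, the leading coefficient of
    \<open>S\<close> comes from \<open>P\<close> alone.\<close>
  define S where "S = s - Polynomial.smult (1 / 2) ?P"
  define N where "N = [:S, [:1 / 2:]:]"
  define M where "M = [:u':]"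
  have u0: "u \<noteq> 0" "u' \<noteq> 0" and deg: "degree u = g" "degree u' = g"
    by (simp_all add: u_def u'_def lax_poly_monic)
  have u: "poly u x = lax_cont I V x 1 g" and u': "poly u' x = shift_cont I V x 1 g" for x
    by (simp_all add: u_def u'_def lax_cont_chi[OF cyc g assms(4)])
  have s: "poly s x = I 1 * cut_cont I V x g" for x
    using g by (simp add: s_def u_def cut_cont_def)
  have N: "poly_uv N x v = poly S x + v / 2" and M: "poly_uv M x v = poly u' x" for x v
    by (simp_all add: N_def M_def)
  have degs: "degree s < g + 1"
  proof -
    have "degree (u - Polynomial.smult (V 1) (lax_poly I V 2 (g - 1))) \<le> g"
      using deg lax_poly_monic[of I V 2 "g - 1"] by (intro degree_diff_le) (auto intro: order.trans[OF degree_smult_le])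
    then show ?thesis unfolding s_def using degree_smult_le[of "I 1"] by (simp add: le_less_trans less_Suc_eq_le order.trans)
  qed
  have S: "degree S = g + 1" "coeff S (g + 1) = - 1 / 2"
  proof -
    have "degree (- Polynomial.smult (1 / 2) ?P) = g + 1" using degree_spec_poly[of g c] by simp
    then show "degree S = g + 1"
      unfolding S_def diff_conv_add_uminus using degs by (subst degree_add_eq_right) auto
    show "coeff S (g + 1) = - 1 / 2"
      unfolding S_def using coeff_eq_0[OF degs] lead_coeff_spec_poly[of g c] by simp
  qed
  have nrm: "norm_poly g c S = Polynomial.smult (- I 1) ([:0, 1:] * (u * u'))"
  proof (rule poly_eq_poly_eq_iff[THEN iffD1], rule ext)
    fix x
    have "poly (norm_poly g c S) x = poly s x * (poly s x - spec_val g I V x) + total_prod g I * total_prod g V"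
      by (simp add: norm_poly_def S_def curve_poly_def P c power2_eq_square algebra_simps)
    also have "\<dots> = - I 1 * x * poly u x * poly u' x"
      unfolding s u u' by (rule norm_identity[OF cyc(1) g])
    finally show "poly (norm_poly g c S) x = poly (Polynomial.smult (- I 1) ([:0, 1:] * (u * u'))) x"
      by (simp add: ac_simps)
  qed
  have nrm0: "norm_poly g c S \<noteq> 0" by (rule norm_poly_nonzero[OF assms(2)])
  have ordX: "Polynomial.order a [:0, 1:] = (if a = 0 then 1 else 0)" for a :: complex
    using order_power_n_n[of 0 1] by (auto simp: order_0I)
  have ordn: "Polynomial.order a (norm_poly g c S) = (if a = 0 then 1 else 0) + Polynomial.order a u + Polynomial.order a u'" for a
    unfolding nrm using I1 u0 by (subst order_smult) (simp_all add: order_mult ordX del: mult_pCons_left)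
  have degn: "degree (norm_poly g c S) = 2 * g + 1"
    unfolding nrm using I1 u0 deg by (simp add: degree_mult_eq)
  have nonzero: "nonzero_on_curve g c N" "nonzero_on_curve g c M"
  proof -
    show "nonzero_on_curve g c N"
      by (rule nonzero_on_curveI[OF nrm0]) (auto simp: poly_norm_poly[OF assms(2)] N)
    show "nonzero_on_curve g c M"
      by (rule nonzero_on_curveI[OF u0(2)]) (auto simp: M)
  qed
  have u_root: "poly S a + b / 2 = 0 \<longleftrightarrow> b = mumford_v g I V a" if "poly u a = 0" for a b
  proof -
    have "poly s a = - (I 1 * V 1 * lax_cont I V a 2 (g - 1))"
      using that by (simp add: s_def u_def)
    then show ?thesis
      by (auto simp: S_def P mumford_v_def field_simps)
  qed
  have u'_root: "poly S a + b / 2 = 0 \<longleftrightarrow> b = - mumford_v g ?I ?V a" if "poly u' a = 0" for a b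
  proof -
    have "poly s a = shift_cont I V a 1 (g + 1)"
      unfolding s using cut_cont_at_root[OF cyc(1) g] that u' by simp
    also have "\<dots> = spec_val g I V a + ?I 1 * ?V 1 * shift_cont I V a 2 (g - 1)"
      using spec_val_conserved[OF cyc g, of a] rel(2)[of 1] by (simp add: algebra_simps)
    finally have "poly S a + b / 2 = (b + mumford_v g ?I ?V a) / 2"
      by (simp add: S_def P mumford_v_def spec_val_chi[OF cyc g assms(4)] lax_cont_chi[OF cyc g assms(4)] field_simps)
    note h = this
    show ?thesis unfolding h by (simp add: eq_neg_iff_add_eq_0)
  qed
  have 0: "poly S 0 + b / 2 = 0 \<longleftrightarrow> b = total_prod g V - total_prod g I" for b
  proof -
    have "poly s 0 = total_prod g I" unfolding s by (simp add: cut_cont_at_0 total_prod_shift)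
    then show ?thesis
      by (auto simp: S_def P spec_val_0[OF cyc(1) g nz(1)] field_simps)
  qed
  let ?E = "phi g c (I, V) + (frag_of (A_point g (I, V)) - frag_of PInf') - phi g c (chi g (I, V))"
  have E: "Poly_Mapping.lookup ?E Q =
      Poly_Mapping.lookup (mumford_div u (mumford_v g I V)) Q
      + (if Q = Aff 0 (total_prod g V - total_prod g I) then 1 else 0) - (if Q = PInf' then 1 else 0)
      - Poly_Mapping.lookup (mumford_div u' (mumford_v g ?I ?V)) Q" for Q
    unfolding chi.simps phi_eq[OF assms(1,3)] phi_eq[OF assms(1) iso'] u_def u'_def
    by (simp only: lookup_add lookup_minus lookup_frag_of_apply A_point.simps)
  have "Poly_Mapping.lookup ?E Q = ord_at g c Q (\<lambda>x v. poly_uv N x v / poly_uv M x v)" if Q: "Q \<in> gam g c" for Q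
  proof (rule sym, rule ord_at_eqI[OF assms(2) Q], unfold N M)
    fix x y assume xy: "local_param g c Q x y"
    have u'_ord: "has_order (\<lambda>t. poly u' (x t)) (poly_order u' Q)"
      by (rule local_param_order_poly[OF assms(2) Q xy u0(2)])
    show "has_order (\<lambda>t. (poly S (x t) + y t / 2) / poly u' (x t)) (Poly_Mapping.lookup ?E Q)"
    \<comment> \<open>At an affine point the order of the norm splits into contributions of
      \<open>x\<close>, \<open>u\<close> and \<open>u'\<close>, counted only where
      \<open>y + s\<close> vanishes. The facts 1, 2 and 3 below match them with \<open>A\<close>,
      the old divisor and the new divisor.\<close>
    proof (cases Q)
      case (Aff a b)
      let ?n = "if poly S a + b / 2 = 0 then int (Polynomial.order a (norm_poly g c S)) else 0"
      have "Poly_Mapping.lookup ?E Q = ?n - poly_order u' Q"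
      proof -
        have on: "b ^ 2 = poly (curve_poly g c) a" using Q Aff by (simp add: gam_def)
        have 1: "(if b = mumford_v g I V a then int (Polynomial.order a u) else 0)
            = (if poly S a + b / 2 = 0 then int (Polynomial.order a u) else 0)"
        proof (cases "poly u a = 0")
          case False
          then show ?thesis by (simp add: order_0I)
        qed (simp only: u_root)
        have 2: "(if Aff a b = Aff 0 (total_prod g V - total_prod g I) then 1 else 0)
            = (if poly S a + b / 2 = 0 then (if a = 0 then 1 else 0) else (0::int))"
          using 0[of b] by auto
        \<comment> \<open>The polynomial \<open>u'\<close> vanishes at both points over its root, or
          doubly at a branch point. Subtracting the zeros shared with \<open>y + s\<close>, which
          lie at the conjugate point, leaves the new divisor.\<close>
        have 3: "(if b = mumford_v g ?I ?V a then int (Polynomial.order a u') else 0)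
            = int (Polynomial.order a u') * (if b = 0 then 2 else 1)
              - (if poly S a + b / 2 = 0 then int (Polynomial.order a u') else 0)"
        proof (cases "poly u' a = 0")
          case False
          then show ?thesis by (simp add: order_0I)
        next
          case True
          have "lax_cont ?I ?V a 1 g = 0" using True by (simp add: u'_def)
          from mumford_v_square[OF assms(1) iso' this]
          have "b = mumford_v g ?I ?V a \<or> b = - mumford_v g ?I ?V a"
            using on by (metis power2_eq_iff)
          then show ?thesis unfolding u'_root[OF True] by auto
        qed
        show ?thesis
          unfolding E Aff lookup_mumford_div[OF u0(1)] lookup_mumford_div[OF u0(2)] point.case poly_order.simps 1 2 3
          by (simp add: ordn)
      qed
      then show ?thesis
        using has_order_divide[OF has_order_linear_Aff[OF assms(2), of a b x y S] u'_ord] Q xy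
        unfolding Aff by simp
    next
      case PInf
      \<comment> \<open>The order \<open>(g + 1) - (2 g + 1) = - g\<close> is cancelled by the pole
        of \<open>u'\<close>. At \<open>PInf'\<close> the pole of order \<open>g + 1\<close> exceeds
        that of \<open>u'\<close> by one.\<close>
      have "has_order (\<lambda>t. poly S (x t) + y t / 2) (- int g)"
        using has_order_linear_PInf[OF assms(2) S, of x y] xy degn unfolding PInf by (simp add: algebra_simps)
      from has_order_divide[OF this u'_ord] show ?thesis
        unfolding E by (simp add: PInf lookup_mumford_div u0 deg)
    next
      case PInf'
      have "has_order (\<lambda>t. poly S (x t) + y t / 2) (- int (g + 1))"
        using has_order_linear_PInf'[OF assms(2) S, of x y] xy unfolding PInf' by simp
      from has_order_divide[OF this u'_ord] show ?thesis
        unfolding E by (simp add: PInf' lookup_mumford_div u0 deg)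
    qed
  qed
  then show ?thesis using nonzero unfolding principal_div_def by blast
qed

theorem theorem6:
  fixes g :: nat and c :: "int \<Rightarrow> complex"
  assumes "g \<ge> 2" and "nonsingular_curve g c"
  shows "\<exists>A \<in> gam g c.
           (\<forall>U \<in> isolevel g c. A_point g U = A) \<and>
           T_div g A \<in> eff_divs g c \<and>
           (\<forall>U \<in> isolevel g c. phi g c U \<in> eff_divs g c) \<and>
           (\<forall>U \<in> isolevel g c. chi_defined g U \<longrightarrow>
              chi g U \<in> isolevel g c \<and>
              mu (phi g c (chi g U)) \<in> sym_sum g c (mu (phi g c U)) (mu (T_div g A)))"
proof -
  obtain A where A: "A \<in> gam g c" "\<forall>U \<in> isolevel g c. A_point g U = A"
  proof (cases "isolevel g c = {}")
    case True
    \<comment> \<open>On an empty isolevel set any point of the curve serves as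
      \<open>A\<close>.\<close>
    then show ?thesis using that[of PInf] by (simp add: gam_def)
  next
    case False
    then obtain I V where "(I, V) \<in> isolevel g c" by auto
    then show ?thesis
      using that[of "A_point g (I, V)"] A_point_in_gam A_point_unique assms(1) by blast
  qed
  note T = T_div_in_eff_divs[OF assms(1) A(1)]
  have ph: "phi g c U \<in> eff_divs g c" if "U \<in> isolevel g c" for U
    using phi_in_eff_divs[OF assms(1)] that by (cases U) auto
  have "chi g U \<in> isolevel g c \<and> mu (phi g c (chi g U)) \<in> sym_sum g c (mu (phi g c U)) (mu (T_div g A))"
    if U: "U \<in> isolevel g c" "chi_defined g U" for U
  proof -
    obtain I V where IV: "U = (I, V)" by (cases U)
    have chi: "chi g U \<in> isolevel g c"
      using chi_in_isolevel[OF assms(1)] U unfolding IV by simp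
    have "phi g c U + T_div g A - D_star g - phi g c (chi g U)
        = phi g c U + (frag_of A - frag_of PInf') - phi g c (chi g U)"
      unfolding T_div_minus_D_star[OF assms(1), symmetric] by simp
    then have "principal_div g c (phi g c U + T_div g A - D_star g - phi g c (chi g U))"
      using principal_translation[OF assms, of I V] A(2) U unfolding IV by metis
    from sym_sumI[OF assms(2) ph[OF U(1)] T ph[OF chi] this] chi show ?thesis by blast
  qed
  then show ?thesis using A T ph by blast
qed

end
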